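(* Consider the multi-queue bandit described in the context, with any problem instance $(\boldsymbol\lambda,\boldsymbol\mu)$ with a unique optimal matching, any $\alpha\in(0,1)$ and any $\alpha$-consistent policy. Let $D(\boldsymbol\mu)=\frac{\Delta}{\mathrm{KL}\left(\mu_{\min},\frac{\mu_{\max}+1}{2}\right)}$. Then (a) $\displaystyle \frac1U\sum_{u\in[U]}\Psi_u(t)\ge\left(\frac{\lambda_{\min}}{8}D(\boldsymbol\mu)(1-\alpha)(K-1)\right)\frac1t$ for infinitely many $t$; and (b) for any $u\in[U]$, $\displaystyle \Psi_u(t)\ge\left(\frac{\lambda_{\min}}{8}D(\boldsymbol\mu)(1-\alpha)\max\{U-1,2(K-U)\}\right)\frac1t$ for infinitely many $t$.
   Context: Discrete-time system with $U$ queues and $K$ servers, $1\le U\le K$. Arrivals $A_u(t)\in\{0,1\}$ to queue $u$ are Bernoulli($\lambda_u$), and the service $R_{uk}(t)\in\{0,1\}$ that server $k$ offers queue $u$ at time $t$ is Bernoulli($\mu_{uk}$); all mutually independent and i.i.d. across slots. In each slot a policy schedules a matching between queues and servers (each server serves at most one queue, each queue at most one server), based only on past observations (scheduled matchings, observed services, arrivals) and independent internal randomness; the parameters are unknown. $\kappa_u(t)$ is the server assigned to queue $u$, $S_u(t)=R_{u\kappa_u(t)}(t)$ (0 if unassigned), $Q_u(t)=(Q_u(t-1)+A_u(t)-S_u(t))^+$. Unique optimal matching: for each $u$, $\mu^*_u=\max_k\mu_{uk}$ is attained at a unique $k^*_u$, and $k^*_u\ne k^*_{u'}$ for $u\ne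 u'$; stability: $\epsilon_u=\mu^*_u-\lambda_u>0$ for all $u$. The genie queue $Q^*_u$ uses the same arrivals and always server $k^*_u$. $Q_u(0)$ and $Q^*_u(0)$ are distributed according to the stationary distribution of $Q^*_u$. Regret: $\Psi_u(t)=\mathbb{E}[Q_u(t)-Q^*_u(t)]$. Notation: $\Delta=\min_{u,\,k\ne k^*_u}(\mu^*_u-\mu_{uk})$, $\mu_{\min}=\min_{u,k}\mu_{uk}$, $\mu_{\max}=\max_{u,k}\mu_{uk}$, $\lambda_{\min}=\min_u\lambda_u$, $\mathrm{KL}(p,q)=p\log\frac pq+(1-p)\log\frac{1-p}{1-q}$. With $T_{uk}(t)=\sum_{s=1}^t\mathbf 1\{\kappa_u(s)=k\}$, a policy is $\alpha$-consistent if for every problem instance satisfying these assumptions, $\mathbb{E}[T_{uk}(t)]=O(t^\alpha)$ for every $u$ and every $k\ne k^*_u$. *)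

theory Defs
  imports "HOL-Probability.Probability" "HOL-Library.Landau_Symbols"
begin

text \<open>Queues are indexed by 0..<U, servers by 0..<K.
  A matching is a map from queues to optional servers.
  A slot records the matching used, the arrivals A u, and the full
  service realisation R (u,k). The policy only sees observations:
  matching, arrivals, and the services S u of the scheduled pairs.\<close>

type_synonym matching = "nat \<Rightarrow> nat option"
type_synonym slot = "matching \<times> (nat \<Rightarrow> bool) \<times> (nat \<times> nat \<Rightarrow> bool)"
type_synonym obs = "matching \<times> (nat \<Rightarrow> bool) \<times> (nat \<Rightarrow> bool)"
type_synonym policy = "obs list \<Rightarrow> matching pmf"

definition valid_matching :: "nat \<Rightarrow> nat \<Rightarrow> matching \<Rightarrow> bool" where
  "valid_matching U K m \<longleftrightarrow>
     (\<forall>u. u \<ge> U \<longrightarrow> m u = None) \<and>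
     (\<forall>u k. m u = Some k \<longrightarrow> k < K) \<and>
     (\<forall>u u' k. u < U \<longrightarrow> u' < U \<longrightarrow> m u = Some k \<longrightarrow> m u' = Some k \<longrightarrow> u = u')"

definition valid_policy :: "nat \<Rightarrow> nat \<Rightarrow> policy \<Rightarrow> bool" where
  "valid_policy U K pol \<longleftrightarrow> (\<forall>h. set_pmf (pol h) \<subseteq> {m. valid_matching U K m})"

definition served :: "matching \<Rightarrow> (nat \<times> nat \<Rightarrow> bool) \<Rightarrow> nat \<Rightarrow> bool" where
  "served m r u = (case m u of None \<Rightarrow> False | Some k \<Rightarrow> r (u, k))"

definition observe :: "slot \<Rightarrow> obs" where
  "observe s = (case s of (m, a, r) \<Rightarrow> (m, a, served m r))"

definition arrivals_pmf :: "nat \<Rightarrow> (nat \<Rightarrow> real) \<Rightarrow> (nat \<Rightarrow> bool) pmf" where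
  "arrivals_pmf U lam = Pi_pmf {..<U} False (\<lambda>u. bernoulli_pmf (lam u))"

definition services_pmf :: "nat \<Rightarrow> nat \<Rightarrow> (nat \<Rightarrow> nat \<Rightarrow> real) \<Rightarrow> (nat \<times> nat \<Rightarrow> bool) pmf" where
  "services_pmf U K mu = Pi_pmf ({..<U} \<times> {..<K}) False (\<lambda>(u,k). bernoulli_pmf (mu u k))"

fun traj :: "nat \<Rightarrow> nat \<Rightarrow> (nat \<Rightarrow> real) \<Rightarrow> (nat \<Rightarrow> nat \<Rightarrow> real) \<Rightarrow> policy \<Rightarrow> nat \<Rightarrow> slot list pmf" where
  "traj U K lam mu pol 0 = return_pmf []"
| "traj U K lam mu pol (Suc t) =
     bind_pmf (traj U K lam mu pol t) (\<lambda>h.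
     bind_pmf (pol (map observe h)) (\<lambda>m.
     bind_pmf (arrivals_pmf U lam) (\<lambda>a.
     map_pmf (\<lambda>r. h @ [(m, a, r)]) (services_pmf U K mu))))"

text \<open>Queue recursion Q(t) = (Q(t-1) + A(t) - S(t))^+ (truncated nat subtraction).\<close>
definition qstep :: "nat \<Rightarrow> bool \<Rightarrow> bool \<Rightarrow> nat" where
  "qstep q a s = q + of_bool a - of_bool s"

definition queue_len :: "nat \<Rightarrow> nat \<Rightarrow> slot list \<Rightarrow> nat" where
  "queue_len u q0 h = foldl (\<lambda>q (m, a, r). qstep q (a u) (served m r u)) q0 h"

definition mu_star :: "nat \<Rightarrow> (nat \<Rightarrow> nat \<Rightarrow> real) \<Rightarrow> nat \<Rightarrow> real" where
  "mu_star K mu u = Max {mu u k | k. k < K}"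

definition opt_server :: "nat \<Rightarrow> (nat \<Rightarrow> nat \<Rightarrow> real) \<Rightarrow> nat \<Rightarrow> nat" where
  "opt_server K mu u = (THE k. k < K \<and> (\<forall>k'. k' < K \<longrightarrow> k' \<noteq> k \<longrightarrow> mu u k' < mu u k))"

definition genie_len :: "nat \<Rightarrow> (nat \<Rightarrow> nat \<Rightarrow> real) \<Rightarrow> nat \<Rightarrow> nat \<Rightarrow> slot list \<Rightarrow> nat" where
  "genie_len K mu u q0 h = foldl (\<lambda>q (m, a, r). qstep q (a u) (r (u, opt_server K mu u))) q0 h"

definition genie_kernel :: "real \<Rightarrow> real \<Rightarrow> nat \<Rightarrow> nat pmf" where
  "genie_kernel l m q =
     map_pmf (\<lambda>(a, s). qstep q a s) (pair_pmf (bernoulli_pmf l) (bernoulli_pmf m))"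

definition stat_dist :: "real \<Rightarrow> real \<Rightarrow> nat pmf" where
  "stat_dist l m = (THE p. bind_pmf p (genie_kernel l m) = p)"

definition init_dist :: "nat \<Rightarrow> (nat \<Rightarrow> real) \<Rightarrow> (nat \<Rightarrow> nat \<Rightarrow> real) \<Rightarrow> nat \<Rightarrow> nat pmf" where
  "init_dist K lam mu u = stat_dist (lam u) (mu_star K mu u)"

definition regret :: "nat \<Rightarrow> nat \<Rightarrow> (nat \<Rightarrow> real) \<Rightarrow> (nat \<Rightarrow> nat \<Rightarrow> real) \<Rightarrow> policy \<Rightarrow> nat \<Rightarrow> nat \<Rightarrow> real" where
  "regret U K lam mu pol u t =
     measure_pmf.expectation (pair_pmf (init_dist K lam mu u) (traj U K lam mu pol t))
        (\<lambda>(q0, h). real (queue_len u q0 h))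
   - measure_pmf.expectation (pair_pmf (init_dist K lam mu u) (traj U K lam mu pol t))
        (\<lambda>(q0, h). real (genie_len K mu u q0 h))"

definition exp_pulls :: "nat \<Rightarrow> nat \<Rightarrow> (nat \<Rightarrow> real) \<Rightarrow> (nat \<Rightarrow> nat \<Rightarrow> real) \<Rightarrow> policy \<Rightarrow> nat \<Rightarrow> nat \<Rightarrow> nat \<Rightarrow> real" where
  "exp_pulls U K lam mu pol u k t =
     measure_pmf.expectation (traj U K lam mu pol t)
        (\<lambda>h. real (length (filter (\<lambda>(m, a, r). m u = Some k) h)))"

definition valid_instance :: "nat \<Rightarrow> nat \<Rightarrow> (nat \<Rightarrow> real) \<Rightarrow> (nat \<Rightarrow> nat \<Rightarrow> real) \<Rightarrow> bool" where
  "valid_instance U K lam mu \<longleftrightarrow>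
     1 \<le> U \<and> U \<le> K \<and>
     (\<forall>u<U. 0 \<le> lam u \<and> lam u \<le> 1) \<and>
     (\<forall>u<U. \<forall>k<K. 0 \<le> mu u k \<and> mu u k \<le> 1) \<and>
     (\<forall>u<U. \<exists>k<K. \<forall>k'<K. k' \<noteq> k \<longrightarrow> mu u k' < mu u k) \<and>
     (\<forall>u<U. \<forall>u'<U. u \<noteq> u' \<longrightarrow> opt_server K mu u \<noteq> opt_server K mu u') \<and>
     (\<forall>u<U. mu_star K mu u - lam u > 0)"

definition consistent :: "nat \<Rightarrow> nat \<Rightarrow> real \<Rightarrow> policy \<Rightarrow> bool" where
  "consistent U K \<alpha> pol \<longleftrightarrow>
     (\<forall>lam mu. valid_instance U K lam mu \<longrightarrow>
        (\<forall>u<U. \<forall>k<K. k \<noteq> opt_server K mu u \<longrightarrow>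
           (\<lambda>t. exp_pulls U K lam mu pol u k t) \<in> O(\<lambda>t. real t powr \<alpha>)))"

definition KL :: "real \<Rightarrow> real \<Rightarrow> real" where
  "KL p q = p * ln (p / q) + (1 - p) * ln ((1 - p) / (1 - q))"

definition gap :: "nat \<Rightarrow> nat \<Rightarrow> (nat \<Rightarrow> nat \<Rightarrow> real) \<Rightarrow> real" where
  "gap U K mu = Min {mu_star K mu u - mu u k | u k. u < U \<and> k < K \<and> k \<noteq> opt_server K mu u}"

definition mu_min :: "nat \<Rightarrow> nat \<Rightarrow> (nat \<Rightarrow> nat \<Rightarrow> real) \<Rightarrow> real" where
  "mu_min U K mu = Min {mu u k | u k. u < U \<and> k < K}"

definition mu_max :: "nat \<Rightarrow> nat \<Rightarrow> (nat \<Rightarrow> nat \<Rightarrow> real) \<Rightarrow> real" where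
  "mu_max U K mu = Max {mu u k | u k. u < U \<and> k < K}"

definition lam_min :: "nat \<Rightarrow> (nat \<Rightarrow> real) \<Rightarrow> real" where
  "lam_min U lam = Min {lam u | u. u < U}"

text \<open>D(mu) = Delta / KL(mu_min, (mu_max+1)/2); if mu_max = 1 the KL divergence is +infinity
  (or the instance has K = 1), and D is taken to be 0.\<close>
definition D_const :: "nat \<Rightarrow> nat \<Rightarrow> (nat \<Rightarrow> nat \<Rightarrow> real) \<Rightarrow> real" where
  "D_const U K mu = (if mu_max U K mu = 1 then 0
     else gap U K mu / KL (mu_min U K mu) ((mu_max U K mu + 1) / 2))"

end

theory Submission
  imports Defs
begin

text \<open>In the last slot, an arrival together with a rate deficit costs queue u at least
  lam u * gap * P(u is not matched to its optimal server), while before that slot the queue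
  stochastically dominates the genie queue.  So a regret eventually below C/t forces the expected number
  of slots up to t in which u misses its optimal server to be at most C' ln t + O(1).

  Conversely, raise to (mu_max + 1)/2 either the rate of one pair (u, k), where k is optimal for no
  queue, or the two rates that exchange the optimal servers of u and u'.  Consistency for the new
  instance makes the old optimal server of u rare there, though it is used almost always under
  the true rates.  A Donsker--Varadhan change of measure along the observed history then shows that the
  altered pairs are scheduled (1 - \<alpha>) ln t / KL times up to lower order.  Since the queues that take the
  optimal server of u make u miss it, summing over all alterations exceeds the upper
  bound.\<close>

section \<open>Change of measure\<close>

text \<open>Consistency limits the use of wrong servers but not idling, and an idle slot is also a
  missed one. So it does not by itself show that a queue uses its optimal server most of the time.
  That fact comes from the negated claim: a logarithmic bound on missed slots makes their fraction
  vanish. The lower bound is thus derived under the very upper bound it refutes, which works because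
  its leading constant does not depend on the constant of that upper bound.

  Constants, with A = (1 - \<alpha>) / KL: settling for a fraction 1/2 of non-missed slots leaves
  A/2 per alteration. The U - 1 exchanges force only A (U - 1) / 4, because a missed slot may be
  charged twice. The larger of the two is A/4 times max {U - 1, 2 (K - U)}, so (b) compares 1/4 with
  1/8. The maximum is at least 2 (K - 1) / 3, so (a) compares 1/6 with 1/8.\<close>

lemma expectation_bind_pmf_finite:
  fixes f :: "'b \<Rightarrow> real"
  assumes "finite (set_pmf p)" "\<And>x. x \<in> set_pmf p \<Longrightarrow> finite (set_pmf (q x))"
  shows "measure_pmf.expectation (bind_pmf p q) f =
         measure_pmf.expectation p (\<lambda>x. measure_pmf.expectation (q x) f)"
  using assms
  by (subst pmf_expectation_bind[of "set_pmf p"], simp_all)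
     (subst integral_measure_pmf[of "set_pmf p"], auto)

lemma finite_set_Pi_pmf_bool:
  fixes p :: "'i \<Rightarrow> bool pmf"
  assumes "finite A"
  shows "finite (set_pmf (Pi_pmf A d p))"
proof -
  have "set_pmf (Pi_pmf A d p) \<subseteq> {f. \<forall>x. (x \<in> A \<longrightarrow> f x \<in> UNIV) \<and> (x \<notin> A \<longrightarrow> f x = d)}"
    using set_Pi_pmf_subset[OF assms] by fastforce
  then show ?thesis
    using finite_set_of_finite_funs[OF assms, of UNIV d] finite_subset by auto
qed

lemma expectation_mono_pmf:
  fixes f g :: "'a \<Rightarrow> real"
  assumes "finite (set_pmf p)" "\<And>x. x \<in> set_pmf p \<Longrightarrow> f x \<le> g x"
  shows "measure_pmf.expectation p f \<le> measure_pmf.expectation p g"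
  using assms by (intro integral_mono_AE integrable_measure_pmf_finite) (auto simp: AE_measure_pmf_iff)

lemma expectation_pos_pmf:
  fixes f :: "'a \<Rightarrow> real"
  assumes "finite (set_pmf p)" "\<And>x. f x > 0"
  shows "measure_pmf.expectation p f > 0"
proof -
  have "measure_pmf.expectation p f = (\<Sum>a\<in>set_pmf p. pmf p a *\<^sub>R f a)"
    using assms by (intro integral_measure_pmf) auto
  also have "\<dots> > 0"
    using assms by (intro sum_pos) (auto simp: set_pmf_not_empty pmf_positive)
  finally show ?thesis .
qed

text \<open>Jensen's inequality, from the tangent of ln at the mean.\<close>

lemma expectation_ln_le_ln_expectation:
  fixes f :: "'a \<Rightarrow> real"
  assumes fin: "finite (set_pmf p)" and pos: "\<And>x. f x > 0"
  shows "measure_pmf.expectation p (\<lambda>x. ln (f x)) \<le> ln (measure_pmf.expectation p f)"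
proof -
  define c where "c = measure_pmf.expectation p f"
  have c: "c > 0" unfolding c_def by (rule expectation_pos_pmf[OF fin pos])
  have "ln (f x) \<le> ln c + (f x / c - 1)" for x
    using ln_le_minus_one[of "f x / c"] pos[of x] c by (simp add: ln_div)
  then have "measure_pmf.expectation p (\<lambda>x. ln (f x))
      \<le> measure_pmf.expectation p (\<lambda>x. ln c + (f x / c - 1))"
    by (intro expectation_mono_pmf fin)
  also have "\<dots> = ln c + (c / c - 1)"
    using fin by (simp add: integrable_measure_pmf_finite c_def)
  finally show ?thesis using c by (simp add: c_def)
qed

section \<open>Variational inequality for Bernoulli and product laws\<close>

lemma weighted_ln_le:
  fixes p q x c :: real
  assumes "0 \<le> p" "0 < q" "0 < x" "0 < c"
  shows "p * ln x - p * ln (p / q) \<le> p * ln c + q * x / c - p"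
proof (cases "p = 0")
  case False
  with assms have p: "p > 0" by simp
  have "p * ln (q * x / (p * c)) \<le> p * (q * x / (p * c) - 1)"
    using p assms by (intro mult_left_mono ln_le_minus_one) auto
  moreover have "ln (q * x / (p * c)) = ln x - ln (p / q) - ln c"
    using p assms by (simp add: ln_div ln_mult)
  moreover have "p * (q * x / (p * c) - 1) = q * x / c - p"
    using p assms by (simp add: field_simps)
  ultimately show ?thesis
    by (simp add: right_diff_distrib)
qed (use assms in auto)

text \<open>Gibbs variational principle on two points, where \<open>x\<close> and \<open>y\<close>
  are the values of a positive function. With c its mean under q, ln z \<le> z - 1 at z = q x / (p
  c) handles one outcome (\<open>weighted_ln_le\<close>); over both outcomes the linear terms
  cancel.\<close>

lemma bernoulli_Donsker_Varadhan:
  fixes p q x y :: real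
  assumes p: "0 \<le> p" "p \<le> 1" and q: "0 < q" "q < 1" and xy: "0 < x" "0 < y"
  shows "p * ln x + (1 - p) * ln y - KL p q \<le> ln (q * x + (1 - q) * y)"
proof -
  define c where "c = q * x + (1 - q) * y"
  have c: "c > 0" unfolding c_def using q xy by (intro add_pos_pos mult_pos_pos) auto
  have 1: "p * ln x - p * ln (p / q) \<le> p * ln c + q * x / c - p"
    using weighted_ln_le p q xy c by simp
  have 2: "(1 - p) * ln y - (1 - p) * ln ((1 - p) / (1 - q))
      \<le> (1 - p) * ln c + (1 - q) * y / c - (1 - p)"
    using weighted_ln_le[of "1 - p" "1 - q" y c] p q xy c by simp
  have 3: "q * x / c + (1 - q) * y / c = 1"
    using c by (simp add: c_def add_divide_distrib[symmetric])
  have 4: "p * ln c + (1 - p) * ln c = ln c" by (simp add: algebra_simps)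
  show ?thesis
    unfolding c_def[symmetric] KL_def using 1 2 3 4 by linarith
qed

lemma KL_nonneg:
  assumes "0 \<le> p" "p \<le> 1" "0 < q" "q < 1"
  shows "0 \<le> KL p q"
  using bernoulli_Donsker_Varadhan[OF assms, of 1 1] by simp

text \<open>Taking the likelihood ratio of p' to q as test function, whose mean under q is 1, bounds
  KL(p, q) below by the tangent of KL(., q) at p'. This tangent is decreasing because p' <
  q.\<close>

lemma KL_antimono:
  assumes "0 \<le> p" "p \<le> p'" "p' < q" "q < 1"
  shows "KL p' q \<le> KL p q"
proof (cases "p' = 0")
  case False
  with assms have p': "p' > 0" by simp
  have "p * ln (p' / q) + (1 - p) * ln ((1 - p') / (1 - q)) - KL p q \<le> 0"
    using bernoulli_Donsker_Varadhan[of p q "p' / q" "(1 - p') / (1 - q)"] assms p' by simp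
  moreover have "p' * ln (p' / q) \<le> p * ln (p' / q)"
    using assms p' by (intro mult_right_mono_neg) auto
  moreover have "(1 - p') * ln ((1 - p') / (1 - q)) \<le> (1 - p) * ln ((1 - p') / (1 - q))"
    using assms p' by (intro mult_right_mono ln_ge_zero) auto
  ultimately show ?thesis unfolding KL_def by linarith
qed (use assms in simp)

text \<open>The Donsker--Varadhan inequality for product laws; a coordinate on which f does not depend
  costs nothing, even if its two laws differ.\<close>
lemma Pi_bernoulli_Donsker_Varadhan:
  fixes f :: "('i \<Rightarrow> bool) \<Rightarrow> real"
  assumes "finite A" "\<And>r. f r > 0"
    and "\<And>x. x \<in> A \<Longrightarrow> 0 \<le> p x \<and> p x \<le> 1 \<and> 0 \<le> q x \<and> q x \<le> 1 \<and> 0 \<le> d x"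
    and "\<And>x. x \<in> A \<Longrightarrow> (\<forall>r b. f (r(x := b)) = f r) \<or> p x = q x
           \<or> (0 < q x \<and> q x < 1 \<and> KL (p x) (q x) \<le> d x)"
  shows "measure_pmf.expectation (Pi_pmf A False (\<lambda>x. bernoulli_pmf (p x))) (\<lambda>r. ln (f r)) - sum d A
         \<le> ln (measure_pmf.expectation (Pi_pmf A False (\<lambda>x. bernoulli_pmf (q x))) f)"
  using assms
proof (induction A arbitrary: f rule: finite_induct)
  case empty
  then show ?case by simp
next
  case (insert x A)
  note pos = insert.prems(1)
  have fin: "finite (set_pmf (Pi_pmf A False (\<lambda>x. bernoulli_pmf (s x))))" for s :: "'i \<Rightarrow> real"
    by (rule finite_set_Pi_pmf_bool) fact
  have split: "measure_pmf.expectation (Pi_pmf (insert x A) False (\<lambda>x. bernoulli_pmf (s x))) g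
      = measure_pmf.expectation (Pi_pmf A False (\<lambda>x. bernoulli_pmf (s x)))
          (\<lambda>r. g (r(x := True)) * s x + g (r(x := False)) * (1 - s x))"
    if "0 \<le> s x" "s x \<le> 1" for s :: "'i \<Rightarrow> real" and g :: "('i \<Rightarrow> bool) \<Rightarrow> real"
  proof -
    have "Pi_pmf (insert x A) False (\<lambda>x. bernoulli_pmf (s x)) =
      bind_pmf (Pi_pmf A False (\<lambda>x. bernoulli_pmf (s x)))
        (\<lambda>r. map_pmf (\<lambda>b. r(x := b)) (bernoulli_pmf (s x)))"
      unfolding Pi_pmf_insert'[OF insert.hyps] map_pmf_def
      by (subst bind_commute_pmf) simp
    then show ?thesis
      using that by (subst \<open>Pi_pmf (insert x A) False _ = _\<close>, subst expectation_bind_pmf_finite)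
        (auto simp: fin)
  qed
  have px: "0 \<le> p x" "p x \<le> 1" "0 \<le> q x" "q x \<le> 1" "0 \<le> d x"
    using insert.prems(2) by auto
  \<comment> \<open>Coordinate x is integrated out under its q-law, so that the induction hypothesis
    can treat the remaining coordinates with \<open>G\<close> as test function; \<open>d x\<close>
    pays for this one coordinate.\<close>
  define G where "G r = f (r(x := True)) * q x + f (r(x := False)) * (1 - q x)" for r
  have Gpos: "G r > 0" for r
    using expectation_pos_pmf[of "bernoulli_pmf (q x)" "\<lambda>b. f (r(x := b))"] px pos
    by (simp add: G_def)
  have step: "ln (f (r(x := True))) * p x + ln (f (r(x := False))) * (1 - p x) - d x \<le> ln (G r)" for r
  proof -
    consider "\<forall>r b. f (r(x := b)) = f r" | "p x = q x"
      | "0 < q x" "q x < 1" "KL (p x) (q x) \<le> d x"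
      using insert.prems(3)[OF insertI1] by blast
    then show ?thesis
    proof cases
      case 1
      then show ?thesis using px by (simp add: G_def algebra_simps)
    next
      case 2
      have "measure_pmf.expectation (bernoulli_pmf (q x)) (\<lambda>b. ln (f (r(x := b))))
        \<le> ln (measure_pmf.expectation (bernoulli_pmf (q x)) (\<lambda>b. f (r(x := b))))"
        using pos by (intro expectation_ln_le_ln_expectation) auto
      then show ?thesis using 2 px by (simp add: G_def)
    next
      case 3
      then show ?thesis
        using bernoulli_Donsker_Varadhan[of "p x" "q x" "f (r(x := True))" "f (r(x := False))"] px pos
        by (simp add: G_def algebra_simps)
    qed
  qed
  have IH: "measure_pmf.expectation (Pi_pmf A False (\<lambda>x. bernoulli_pmf (p x))) (\<lambda>r. ln (G r)) - sum d A
         \<le> ln (measure_pmf.expectation (Pi_pmf A False (\<lambda>x. bernoulli_pmf (q x))) G)"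
  proof (rule insert.IH[OF Gpos])
    fix y assume y: "y \<in> A"
    then have xy: "x \<noteq> y" using insert.hyps by auto
    show "0 \<le> p y \<and> p y \<le> 1 \<and> 0 \<le> q y \<and> q y \<le> 1 \<and> 0 \<le> d y"
      using insert.prems(2) y by auto
    \<comment> \<open>Updates at distinct coordinates commute, so averaging over x keeps the
      independence of y.\<close>
    have "\<forall>r b. G (r(y := b)) = G r" if "\<forall>r b. f (r(y := b)) = f r"
      using that xy unfolding G_def by (metis fun_upd_twist)
    then show "(\<forall>r b. G (r(y := b)) = G r) \<or> p y = q y
           \<or> (0 < q y \<and> q y < 1 \<and> KL (p y) (q y) \<le> d y)"
      using insert.prems(3)[OF insertI2[OF y]] by blast
  qed
  have "measure_pmf.expectation (Pi_pmf (insert x A) False (\<lambda>x. bernoulli_pmf (p x))) (\<lambda>r. ln (f r)) - d x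
      = measure_pmf.expectation (Pi_pmf A False (\<lambda>x. bernoulli_pmf (p x)))
         (\<lambda>r. ln (f (r(x := True))) * p x + ln (f (r(x := False))) * (1 - p x) - d x)"
    using px fin by (simp add: split integrable_measure_pmf_finite)
  also have "\<dots> \<le> measure_pmf.expectation (Pi_pmf A False (\<lambda>x. bernoulli_pmf (p x))) (\<lambda>r. ln (G r))"
    by (intro expectation_mono_pmf fin step)
  finally show ?case
    using IH insert.hyps px by (simp add: split[of q] G_def[abs_def])
qed

section \<open>Observed trajectories\<close>

text \<open>This makes all trajectory laws finitely supported, so integrability is an issue only for
  the initial queue length.\<close>

lemma finite_valid_matchings: "finite {m. valid_matching U K m}"
proof (rule finite_subset)
  show "{m. valid_matching U K m} \<subseteq>
      {m. \<forall>u. (u \<in> {..<U} \<longrightarrow> m u \<in> insert None (Some ` {..<K})) \<and> (u \<notin> {..<U} \<longrightarrow> m u = None)}"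
  proof safe
    fix m u assume m: "valid_matching U K m" and "m u \<notin> Some ` {..<K}"
    then show "m u = None"
      by (cases "m u") (auto simp: valid_matching_def)
  qed (fastforce simp: valid_matching_def not_less[symmetric])
qed (intro finite_set_of_finite_funs; simp)

lemma finite_set_arrivals [simp]: "finite (set_pmf (arrivals_pmf U lam))"
  unfolding arrivals_pmf_def by (intro finite_set_Pi_pmf_bool) simp

lemma finite_set_services [simp]: "finite (set_pmf (services_pmf U K mu))"
  unfolding services_pmf_def by (intro finite_set_Pi_pmf_bool) simp

lemma length_traj: "h \<in> set_pmf (traj U K lam mu pol t) \<Longrightarrow> length h = t"
  by (induction t arbitrary: h) auto

text \<open>A predicate on matchings lets one notion cover both pulls of a pair and slots in which a
  queue misses its optimal server, idle slots included.\<close>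

definition exp_count ::
  "nat \<Rightarrow> nat \<Rightarrow> (nat \<Rightarrow> real) \<Rightarrow> (nat \<Rightarrow> nat \<Rightarrow> real) \<Rightarrow> policy \<Rightarrow> (matching \<Rightarrow> bool) \<Rightarrow> nat \<Rightarrow> real" where
  "exp_count U K lam mu pol P t =
     measure_pmf.expectation (traj U K lam mu pol t)
        (\<lambda>h. real (length (filter (\<lambda>(m, a, r). P m) h)))"

lemma exp_pulls_eq_exp_count:
  "exp_pulls U K lam mu pol u k = exp_count U K lam mu pol (\<lambda>m. m u = Some k)"
  by (simp add: fun_eq_iff exp_pulls_def exp_count_def)

lemma exp_count_0 [simp]: "exp_count U K lam mu pol P 0 = 0"
  by (simp add: exp_count_def)

lemma exp_count_nonneg: "exp_count U K lam mu pol P t \<ge> 0"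
  by (simp add: exp_count_def integral_nonneg_AE)

locale valid_policy_system =
  fixes U K :: nat and pol :: policy
  assumes valid_policy: "valid_policy U K pol"
begin

lemma valid_matching_policy: "m \<in> set_pmf (pol h) \<Longrightarrow> valid_matching U K m"
  using valid_policy unfolding valid_policy_def by blast

lemma finite_set_policy [simp]: "finite (set_pmf (pol h))"
  using finite_valid_matchings[of U K] valid_matching_policy by (metis finite_subset mem_Collect_eq subsetI)

lemma finite_set_traj [simp]: "finite (set_pmf (traj U K lam mu pol t))"
  by (induction t) auto

lemma expectation_traj_Suc:
  fixes f :: "slot list \<Rightarrow> real"
  shows "measure_pmf.expectation (traj U K lam mu pol (Suc t)) f =
    measure_pmf.expectation (traj U K lam mu pol t) (\<lambda>h.
    measure_pmf.expectation (pol (map observe h)) (\<lambda>m.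
    measure_pmf.expectation (arrivals_pmf U lam) (\<lambda>a.
    measure_pmf.expectation (services_pmf U K mu) (\<lambda>r. f (h @ [(m, a, r)])))))"
  by (simp add: expectation_bind_pmf_finite)

lemma exp_count_Suc:
  "exp_count U K lam mu pol P (Suc t) = exp_count U K lam mu pol P t +
    measure_pmf.expectation (traj U K lam mu pol t) (\<lambda>h.
    measure_pmf.expectation (pol (map observe h)) (\<lambda>m. of_bool (P m)))"
proof -
  have "length (filter (\<lambda>(m, a, r). P m) (h @ [(m, a, r)])) =
      length (filter (\<lambda>(m, a, r). P m) h) + of_bool (P m)" for h :: "slot list" and m a r
    by simp
  then show ?thesis
    by (simp add: exp_count_def expectation_traj_Suc integrable_measure_pmf_finite
          del: filter_append traj.simps)
qed

lemma exp_count_le_Suc: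
  "exp_count U K lam mu pol P t \<le> exp_count U K lam mu pol P (Suc t)"
  by (simp add: exp_count_Suc integral_nonneg_AE)

text \<open>The policy draws only valid matchings, so an inequality between indicators on those
  passes to expected counts. This is how the matching constraints reach the expectations.\<close>

lemma sum_exp_count_le:
  assumes le: "\<And>m. valid_matching U K m \<Longrightarrow> (\<Sum>i\<in>I. of_bool (P i m)) \<le> (of_bool (R m) :: real)"
  shows "(\<Sum>i\<in>I. exp_count U K lam mu pol (P i) t) \<le> exp_count U K lam mu pol R t"
proof (induction t)
  case (Suc t)
  have "(\<Sum>i\<in>I. measure_pmf.expectation (traj U K lam mu pol t) (\<lambda>h.
          measure_pmf.expectation (pol (map observe h)) (\<lambda>m. of_bool (P i m) :: real))) =
        measure_pmf.expectation (traj U K lam mu pol t) (\<lambda>h.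
          measure_pmf.expectation (pol (map observe h)) (\<lambda>m. \<Sum>i\<in>I. of_bool (P i m)))"
    by (simp add: integrable_measure_pmf_finite)
  also have "\<dots> \<le> measure_pmf.expectation (traj U K lam mu pol t) (\<lambda>h.
          measure_pmf.expectation (pol (map observe h)) (\<lambda>m. of_bool (R m)))"
    by (intro expectation_mono_pmf le finite_set_policy finite_set_traj) (auto intro: valid_matching_policy)
  finally show ?case
    using Suc by (simp add: exp_count_Suc sum.distrib)
qed simp

text \<open>Change of measure along the observed history: altering the service rates of the pairs in B
  costs at most c for every slot in which such a pair is scheduled.\<close>
lemma traj_Donsker_Varadhan:
  fixes F :: "obs list \<Rightarrow> real"
  assumes mu: "\<And>v j. v < U \<Longrightarrow> j < K \<Longrightarrow> 0 \<le> mu v j \<and> mu v j \<le> 1 \<and> 0 \<le> mu' v j \<and> mu' v j \<le> 1"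
    and B: "B \<subseteq> {..<U} \<times> {..<K}"
    and eq: "\<And>v j. v < U \<Longrightarrow> j < K \<Longrightarrow> (v, j) \<notin> B \<Longrightarrow> mu' v j = mu v j"
    and ch: "\<And>v j. (v, j) \<in> B \<Longrightarrow> 0 < mu' v j \<and> mu' v j < 1 \<and> KL (mu v j) (mu' v j) \<le> c"
    and c: "0 \<le> c"
    and F: "\<And>x. F x > 0"
  shows "measure_pmf.expectation (traj U K lam mu pol t) (\<lambda>h. ln (F (map observe h)))
      - c * (\<Sum>(v, j)\<in>B. exp_pulls U K lam mu pol v j t)
      \<le> ln (measure_pmf.expectation (traj U K lam mu' pol t) (\<lambda>h. F (map observe h)))"
  using F
proof (induction t arbitrary: F)
  case 0
  then show ?case by (simp add: exp_pulls_eq_exp_count case_prod_beta)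
next
  case (Suc t)
  define cost :: "matching \<Rightarrow> real" where "cost m = (\<Sum>(v, j)\<in>B. of_bool (m v = Some j))" for m
  \<comment> \<open>Backward induction: \<open>G x\<close> is the mean of F after one more slot
    under the altered rates, given the observed history x. It is again a function of the observed
    history, because the policy depends on nothing else.\<close>
  define S where "S x m a = measure_pmf.expectation (services_pmf U K mu')
    (\<lambda>r. F (x @ [(m, a, served m r)]))" for x m a
  define G where "G x = measure_pmf.expectation (pol x) (\<lambda>m.
    measure_pmf.expectation (arrivals_pmf U lam) (\<lambda>a. S x m a))" for x
  have Spos: "S x m a > 0" for x m a
    unfolding S_def by (intro expectation_pos_pmf finite_set_services Suc.prems)
  have Gpos: "G x > 0" for x
    unfolding G_def by (intro expectation_pos_pmf Spos finite_set_policy finite_set_traj finite_set_arrivals)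
  have slot: "measure_pmf.expectation (services_pmf U K mu) (\<lambda>r. ln (F (x @ [(m, a, served m r)])))
      - c * cost m \<le> ln (S x m a)" for x m a
  proof -
    \<comment> \<open>Only a pair that is both altered and scheduled is charged; the service of any
      other pair either is unobserved or has the same law under both instances.\<close>
    let ?d = "\<lambda>z. c * of_bool (z \<in> B \<and> m (fst z) = Some (snd z))"
    have "(\<Sum>z\<in>{..<U}\<times>{..<K}. ?d z) = c * cost m"
      unfolding cost_def case_prod_beta sum_distrib_left
      by (rule sum.mono_neutral_cong_right) (use B in auto)
    moreover have "measure_pmf.expectation
        (Pi_pmf ({..<U}\<times>{..<K}) False (\<lambda>z. bernoulli_pmf (case_prod mu z)))
        (\<lambda>r. ln (F (x @ [(m, a, served m r)]))) - (\<Sum>z\<in>{..<U}\<times>{..<K}. ?d z)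
      \<le> ln (measure_pmf.expectation
        (Pi_pmf ({..<U}\<times>{..<K}) False (\<lambda>z. bernoulli_pmf (case_prod mu' z)))
        (\<lambda>r. F (x @ [(m, a, served m r)])))"
    proof (rule Pi_bernoulli_Donsker_Varadhan)
      fix z assume z: "z \<in> {..<U}\<times>{..<K}"
      obtain v j where vj: "z = (v, j)" by (cases z)
      have vK: "v < U" "j < K" using z vj by auto
      show "0 \<le> case_prod mu z \<and> case_prod mu z \<le> 1 \<and> 0 \<le> case_prod mu' z \<and> case_prod mu' z \<le> 1 \<and> 0 \<le> ?d z"
        using mu[OF vK] c vj by auto
      have "served m (r(z := b)) = served m r" if "m v \<noteq> Some j" for r b
        using that unfolding served_def vj by (auto simp: fun_eq_iff split: option.splits)
      then show "(\<forall>r b. F (x @ [(m, a, served m (r(z := b)))]) = F (x @ [(m, a, served m r)]))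
          \<or> case_prod mu z = case_prod mu' z
          \<or> (0 < case_prod mu' z \<and> case_prod mu' z < 1 \<and> KL (case_prod mu z) (case_prod mu' z) \<le> ?d z)"
        using eq[OF vK] ch[of v j] unfolding vj by (cases "m v = Some j"; cases "(v, j) \<in> B") auto
    qed (auto intro: Suc.prems)
    ultimately show ?thesis
      unfolding S_def services_pmf_def by (simp only: case_prod_beta')
  qed
  have G: "measure_pmf.expectation (pol x) (\<lambda>m. measure_pmf.expectation (arrivals_pmf U lam) (\<lambda>a.
        measure_pmf.expectation (services_pmf U K mu) (\<lambda>r. ln (F (x @ [(m, a, served m r)])))))
      - c * measure_pmf.expectation (pol x) cost \<le> ln (G x)" for x
  proof -
    have "measure_pmf.expectation (pol x) (\<lambda>m. measure_pmf.expectation (arrivals_pmf U lam) (\<lambda>a.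
        measure_pmf.expectation (services_pmf U K mu) (\<lambda>r. ln (F (x @ [(m, a, served m r)])))))
      - c * measure_pmf.expectation (pol x) cost
      = measure_pmf.expectation (pol x) (\<lambda>m. measure_pmf.expectation (arrivals_pmf U lam) (\<lambda>a.
        measure_pmf.expectation (services_pmf U K mu) (\<lambda>r. ln (F (x @ [(m, a, served m r)])))
        - c * cost m))"
      by (simp add: integrable_measure_pmf_finite)
    also have "\<dots> \<le> measure_pmf.expectation (pol x) (\<lambda>m.
        measure_pmf.expectation (arrivals_pmf U lam) (\<lambda>a. ln (S x m a)))"
      by (intro expectation_mono_pmf slot finite_set_policy finite_set_traj finite_set_arrivals)
    \<comment> \<open>Given the history, matching and arrivals have the same law under both
      instances, so Jensen moves ln outwards past them at no cost.\<close>
    also have "\<dots> \<le> measure_pmf.expectation (pol x) (\<lambda>m.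
        ln (measure_pmf.expectation (arrivals_pmf U lam) (\<lambda>a. S x m a)))"
      by (intro expectation_mono_pmf expectation_ln_le_ln_expectation Spos finite_set_policy finite_set_traj finite_set_arrivals)
    also have "\<dots> \<le> ln (G x)"
      unfolding G_def
      by (intro expectation_ln_le_ln_expectation expectation_pos_pmf Spos finite_set_policy finite_set_traj finite_set_arrivals)
    finally show ?thesis .
  qed
  have pulls: "(\<Sum>(v, j)\<in>B. exp_pulls U K lam mu pol v j (Suc t)) =
      (\<Sum>(v, j)\<in>B. exp_pulls U K lam mu pol v j t) +
      measure_pmf.expectation (traj U K lam mu pol t) (\<lambda>h.
        measure_pmf.expectation (pol (map observe h)) cost)"
    unfolding cost_def exp_pulls_eq_exp_count case_prod_beta exp_count_Suc sum.distrib
    by (simp add: integrable_measure_pmf_finite)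
  have "measure_pmf.expectation (traj U K lam mu pol (Suc t)) (\<lambda>h. ln (F (map observe h)))
      - c * (\<Sum>(v, j)\<in>B. exp_pulls U K lam mu pol v j (Suc t))
    = measure_pmf.expectation (traj U K lam mu pol t) (\<lambda>h.
        measure_pmf.expectation (pol (map observe h)) (\<lambda>m. measure_pmf.expectation (arrivals_pmf U lam) (\<lambda>a.
        measure_pmf.expectation (services_pmf U K mu) (\<lambda>r. ln (F (map observe h @ [(m, a, served m r)])))))
      - c * measure_pmf.expectation (pol (map observe h)) cost)
      - c * (\<Sum>(v, j)\<in>B. exp_pulls U K lam mu pol v j t)"
    unfolding pulls
    by (simp add: expectation_traj_Suc integrable_measure_pmf_finite observe_def
        algebra_simps del: traj.simps)
  also have "\<dots> \<le> measure_pmf.expectation (traj U K lam mu pol t) (\<lambda>h. ln (G (map observe h)))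
      - c * (\<Sum>(v, j)\<in>B. exp_pulls U K lam mu pol v j t)"
    by (intro diff_right_mono expectation_mono_pmf G finite_set_policy finite_set_traj finite_set_arrivals)
  also have "\<dots> \<le> ln (measure_pmf.expectation (traj U K lam mu' pol t) (\<lambda>h. G (map observe h)))"
    by (rule Suc.IH[OF Gpos])
  also have "measure_pmf.expectation (traj U K lam mu' pol t) (\<lambda>h. G (map observe h))
    = measure_pmf.expectation (traj U K lam mu' pol (Suc t)) (\<lambda>h. F (map observe h))"
    by (simp add: expectation_traj_Suc G_def S_def observe_def del: traj.simps)
  finally show ?case .
qed

end

section \<open>Regret of one slot\<close>

text \<open>The one-step Markov operator of a queue with arrival rate l and service rate s, applied
  to a test function g. An arrival can be served in its own slot, hence the term
  \<open>l * s * g q\<close> even at q = 0.\<close>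

definition queue_op :: "real \<Rightarrow> real \<Rightarrow> (nat \<Rightarrow> real) \<Rightarrow> nat \<Rightarrow> real" where
  "queue_op l s g q = l * s * g q + l * (1 - s) * g (q + 1)
     + (1 - l) * s * g (q - 1) + (1 - l) * (1 - s) * g q"

section \<open>The genie queue and its stationary law\<close>

lemma expectation_genie_kernel:
  assumes "0 \<le> l" "l \<le> 1" "0 \<le> s" "s \<le> 1"
  shows "measure_pmf.expectation (genie_kernel l s q) g = queue_op l s g q"
proof -
  have fin: "finite (set_pmf (p :: bool pmf))" for p by simp
  show ?thesis
    using assms unfolding genie_kernel_def pair_pmf_def
    by (simp add: expectation_bind_pmf_finite fin queue_op_def qstep_def algebra_simps)
qed

text \<open>Balancing the probability flow across the cut between n and n + 1.\<close>
lemma stationary_iff_balance: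
  assumes "0 \<le> l" "l \<le> 1" "0 \<le> s" "s \<le> 1"
  shows "bind_pmf p (genie_kernel l s) = p \<longleftrightarrow>
    (\<forall>n. s * (1 - l) * pmf p (Suc n) = l * (1 - s) * pmf p n)"
proof -
  let ?b = "bind_pmf p (genie_kernel l s)"
  have int: "integrable (measure_pmf p) (indicator A :: nat \<Rightarrow> real)" for A
    by (intro measure_pmf.integrable_const_bound[where B=1]) (auto simp: indicator_def)
  \<comment> \<open>A step changes the length by at most 1: \<open>{..n}\<close> is left only from
    n, by an unserved arrival, and entered only from n + 1, by a service without arrival.\<close>
  have ker: "measure (genie_kernel l s q) {..n} =
    indicator {..n} q - l * (1 - s) * indicator {n} q + s * (1 - l) * indicator {Suc n} q" for q n
  proof -
    have "measure (genie_kernel l s q) {..n} = queue_op l s (indicator {..n}) q"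
      using expectation_genie_kernel[OF assms, of q "indicator {..n}"] by simp
    also have "\<dots> = indicator {..n} q - l * (1 - s) * indicator {n} q + s * (1 - l) * indicator {Suc n} q"
      unfolding queue_op_def by (auto simp: indicator_def algebra_simps)
    finally show ?thesis .
  qed
  have cdf: "sum (pmf ?b) {..n} = sum (pmf p) {..n} - l * (1 - s) * pmf p n + s * (1 - l) * pmf p (Suc n)" for n
  proof -
    have "sum (pmf ?b) {..n} = (\<Sum>i\<le>n. measure_pmf.expectation p (\<lambda>q. pmf (genie_kernel l s q) i))"
      by (simp add: pmf_bind)
    also have "\<dots> = measure_pmf.expectation p (\<lambda>q. \<Sum>i\<le>n. pmf (genie_kernel l s q) i)"
      by (subst Bochner_Integration.integral_sum)
        (auto intro!: measure_pmf.integrable_const_bound[where B=1] simp: pmf_le_1)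
    also have "\<dots> = measure_pmf.expectation p (\<lambda>q. indicator {..n} q
        - l * (1 - s) * indicator {n} q + s * (1 - l) * indicator {Suc n} q)"
      by (simp only: ker[symmetric] measure_measure_pmf_finite[OF finite_atMost])
    also have "\<dots> = measure p {..n} - l * (1 - s) * pmf p n + s * (1 - l) * pmf p (Suc n)"
      using int by (simp add: measure_pmf_single)
    finally show ?thesis by (simp add: measure_measure_pmf_finite)
  qed
  show ?thesis
  proof
    assume b: "?b = p"
    show "\<forall>n. s * (1 - l) * pmf p (Suc n) = l * (1 - s) * pmf p n"
      using cdf unfolding b by simp
  next
    assume "\<forall>n. s * (1 - l) * pmf p (Suc n) = l * (1 - s) * pmf p n"
    then have eq: "sum (pmf ?b) {..n} = sum (pmf p) {..n}" for n using cdf by simp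
    show "?b = p"
    proof (rule pmf_eqI)
      fix n show "pmf ?b n = pmf p n"
        using eq[of n] eq[of "n - 1"] by (cases n) auto
    qed
  qed
qed

text \<open>The balance equations are a first-order recursion with ratio \<rho>, and l < s gives
  \<rho> < 1. Uniqueness has to be shown as well, since \<open>stat_dist\<close> is a definite
  description.\<close>

lemma stat_dist_eq_geometric:
  assumes "0 \<le> l" "l < s" "s \<le> 1"
  shows "stat_dist l s = geometric_pmf (1 - l * (1 - s) / (s * (1 - l)))"
    and "1 - l * (1 - s) / (s * (1 - l)) \<in> {0<..1}"
proof -
  define \<rho> where "\<rho> = l * (1 - s) / (s * (1 - l))"
  have pos: "s * (1 - l) > 0" using assms by simp
  have \<rho>: "0 \<le> \<rho>" "\<rho> < 1"
    using assms pos unfolding \<rho>_def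
    by (simp, subst divide_less_eq_1_pos) (auto simp: algebra_simps)
  then show "1 - l * (1 - s) / (s * (1 - l)) \<in> {0<..1}"
    by (simp add: \<rho>_def)
  have iff: "bind_pmf p (genie_kernel l s) = p \<longleftrightarrow> (\<forall>n. pmf p (Suc n) = \<rho> * pmf p n)" for p
    using assms pos by (subst stationary_iff_balance) (auto simp: \<rho>_def field_simps)
  let ?g = "geometric_pmf (1 - \<rho>)"
  have g: "pmf ?g n = \<rho> ^ n * (1 - \<rho>)" for n
    using \<rho> by simp
  have "(THE p. bind_pmf p (genie_kernel l s) = p) = ?g"
  proof (rule the_equality)
    show "bind_pmf ?g (genie_kernel l s) = ?g"
      unfolding iff g by simp
    fix p assume "bind_pmf p (genie_kernel l s) = p"
    then have "pmf p n = \<rho> ^ n * pmf p 0" for n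
      unfolding iff by (induction n) auto
    then have p: "pmf p n = \<rho> ^ n * pmf p 0" for n .
    show "p = ?g"
    proof (rule ccontr)
      assume ne: "p \<noteq> ?g"
      obtain x where "pmf p x < pmf ?g x" using pmf_neq_exists_less[OF ne] by blast
      then have "pmf p 0 < 1 - \<rho>" using \<rho> unfolding p[of x] g
        by (meson mult_left_mono not_less zero_le_power)
      moreover obtain y where "pmf ?g y < pmf p y" using pmf_neq_exists_less[of ?g p] ne by metis
      then have "1 - \<rho> < pmf p 0" using \<rho> unfolding p[of y] g
        by (meson mult_left_mono not_less zero_le_power)
      ultimately show False by simp
    qed
  qed
  then show "stat_dist l s = geometric_pmf (1 - l * (1 - s) / (s * (1 - l)))"
    by (simp add: stat_dist_def \<rho>_def)
qed

text \<open>Ensures that the expectations in \<open>regret\<close> are genuine and not the default 0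
  of a nonintegrable function.\<close>

lemma integrable_stat_dist:
  assumes "0 \<le> l" "l < s" "s \<le> 1"
  shows "integrable (stat_dist l s) real"
  using stat_dist_eq_geometric[OF assms] integrable_real_geometric_pmf by simp

section \<open>Effect of the service rate on one queue step\<close>

lemma queue_op_mono:
  assumes "0 \<le> l" "l \<le> 1" "0 \<le> s" "s \<le> 1" "mono g"
  shows "mono (queue_op l s g)"
proof (rule monoI)
  fix x y :: nat assume "x \<le> y"
  then show "queue_op l s g x \<le> queue_op l s g y"
    unfolding queue_op_def using assms
    by (intro add_mono mult_left_mono monoD[OF \<open>mono g\<close>]) auto
qed

text \<open>The operator is affine in the service rate, with an average increment of g as slope;
  both rate comparisons below rest on this.\<close>

lemma queue_op_diff:
  "queue_op l s g q - queue_op l s' g q =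
     (s' - s) * (l * (g (q + 1) - g q) + (1 - l) * (g q - g (q - 1)))"
  by (simp add: queue_op_def algebra_simps)

lemma queue_op_antimono_rate:
  assumes "0 \<le> l" "l \<le> 1" "s \<le> s'" "mono g"
  shows "queue_op l s' g q \<le> queue_op l s g q"
proof -
  have "g q \<le> g (q + 1)" "g (q - 1) \<le> g q" using \<open>mono g\<close> by (auto intro: monoD)
  then have "0 \<le> (s' - s) * (l * (g (q + 1) - g q) + (1 - l) * (g q - g (q - 1)))"
    using assms by auto
  then show ?thesis using queue_op_diff[of l s g q s'] by simp
qed

text \<open>The upward increment of \<open>real\<close> is 1 even at an empty queue, whereas the
  downward increment vanishes there. Keeping only the upward part is the origin of the factor
  \<lambda> in the regret bound.\<close>

lemma queue_op_real_rate:
  assumes "0 \<le> l" "l \<le> 1" "s \<le> s'"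
  shows "queue_op l s' real q + (s' - s) * l \<le> queue_op l s real q"
proof -
  have "(s' - s) * l \<le> (s' - s) * (l * (real (q + 1) - real q) + (1 - l) * (real q - real (q - 1)))"
    using assms by (intro mult_left_mono) auto
  then show ?thesis using queue_op_diff[of l s real q s'] by simp
qed

section \<open>Expected queue step under a given matching\<close>

lemma expectation_arrival:
  assumes "u < U" "0 \<le> lam u" "lam u \<le> 1"
  shows "measure_pmf.expectation (arrivals_pmf U lam) (\<lambda>a. f (a u)) =
    f True * lam u + f False * (1 - lam u :: real)"
proof -
  have "measure_pmf.expectation (arrivals_pmf U lam) (\<lambda>a. f (a u)) =
    measure_pmf.expectation (map_pmf (\<lambda>a. a u) (arrivals_pmf U lam)) f" by simp
  also have "map_pmf (\<lambda>a. a u) (arrivals_pmf U lam) = bernoulli_pmf (lam u)"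
    using assms unfolding arrivals_pmf_def by (subst Pi_pmf_component) auto
  finally show ?thesis using assms by simp
qed

lemma expectation_service:
  assumes "u < U" "k < K" "0 \<le> mu u k" "mu u k \<le> 1"
  shows "measure_pmf.expectation (services_pmf U K mu) (\<lambda>r. f (r (u, k))) =
    f True * mu u k + f False * (1 - mu u k :: real)"
proof -
  have "measure_pmf.expectation (services_pmf U K mu) (\<lambda>r. f (r (u, k))) =
    measure_pmf.expectation (map_pmf (\<lambda>r. r (u, k)) (services_pmf U K mu)) f" by simp
  also have "map_pmf (\<lambda>r. r (u, k)) (services_pmf U K mu) = bernoulli_pmf (mu u k)"
    using assms unfolding services_pmf_def by (subst Pi_pmf_component) auto
  finally show ?thesis using assms by simp
qed

lemma expectation_qstep_server:
  assumes "u < U" "0 \<le> lam u" "lam u \<le> 1" "k < K" "0 \<le> mu u k" "mu u k \<le> 1"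
  shows "measure_pmf.expectation (arrivals_pmf U lam) (\<lambda>a.
      measure_pmf.expectation (services_pmf U K mu) (\<lambda>r. g (qstep q (a u) (r (u, k)))))
    = queue_op (lam u) (mu u k) g q"
proof -
  have "measure_pmf.expectation (services_pmf U K mu) (\<lambda>r. g (qstep q b (r (u, k)))) =
      g (qstep q b True) * mu u k + g (qstep q b False) * (1 - mu u k)" for b
    using expectation_service[of u U k K mu "\<lambda>x. g (qstep q b x)"] assms by simp
  then show ?thesis
    using expectation_arrival[of u U lam "\<lambda>x. g (qstep q x True) * mu u k + g (qstep q x False) * (1 - mu u k)"]
      assms by (simp only:) (simp add: queue_op_def qstep_def algebra_simps)
qed

lemma expectation_qstep_idle:
  assumes "u < U" "0 \<le> lam u" "lam u \<le> 1"
  shows "measure_pmf.expectation (arrivals_pmf U lam) (\<lambda>a.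
      measure_pmf.expectation (services_pmf U K mu) (\<lambda>r. g (qstep q (a u) False)))
    = queue_op (lam u) 0 g q"
  using assms expectation_arrival[of u U lam "\<lambda>x. g (qstep q x False)"]
  by (simp add: queue_op_def qstep_def algebra_simps)

definition service_rate :: "(nat \<Rightarrow> nat \<Rightarrow> real) \<Rightarrow> matching \<Rightarrow> nat \<Rightarrow> real" where
  "service_rate mu m u = (case m u of None \<Rightarrow> 0 | Some k \<Rightarrow> mu u k)"

lemma expectation_qstep_served:
  assumes "u < U" "0 \<le> lam u" "lam u \<le> 1" "valid_matching U K m"
    "\<And>k. k < K \<Longrightarrow> 0 \<le> mu u k \<and> mu u k \<le> 1"
  shows "measure_pmf.expectation (arrivals_pmf U lam) (\<lambda>a.
      measure_pmf.expectation (services_pmf U K mu) (\<lambda>r. g (qstep q (a u) (served m r u))))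
    = queue_op (lam u) (service_rate mu m u) g q"
proof (cases "m u")
  case None
  then show ?thesis
    using expectation_qstep_idle[of u U lam K mu g q] assms by (simp add: served_def service_rate_def)
next
  case (Some k)
  moreover have "k < K" using Some assms(4) by (auto simp: valid_matching_def)
  ultimately show ?thesis
    using expectation_qstep_server[of u U lam k K mu g q] assms
    by (simp add: served_def service_rate_def)
qed

lemma queue_len_snoc [simp]:
  "queue_len u q0 (h @ [(m, a, r)]) = qstep (queue_len u q0 h) (a u) (served m r u)"
  by (simp add: queue_len_def)

lemma genie_len_snoc [simp]:
  "genie_len K mu u q0 (h @ [(m, a, r)]) =
     qstep (genie_len K mu u q0 h) (a u) (r (u, opt_server K mu u))"
  by (simp add: genie_len_def)

lemma queue_len_le: "queue_len u q0 h \<le> q0 + length h"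
  by (induction h rule: rev_induct) (auto simp: queue_len_def qstep_def)

lemma genie_len_le: "genie_len K mu u q0 h \<le> q0 + length h"
  by (induction h rule: rev_induct) (auto simp: genie_len_def qstep_def)

text \<open>Tonelli, for an initial law of infinite support: if the common nonnegative integral is
  infinite, both sides are 0.\<close>

lemma expectation_pair_pmf_nonneg:
  fixes f :: "'a \<Rightarrow> 'b \<Rightarrow> real"
  assumes "finite (set_pmf q)" "\<And>x y. 0 \<le> f x y"
  shows "measure_pmf.expectation (pair_pmf p q) (\<lambda>(x, y). f x y) =
    measure_pmf.expectation p (\<lambda>x. measure_pmf.expectation q (f x))"
proof -
  have "measure_pmf.expectation (pair_pmf p q) (\<lambda>(x, y). f x y) =
      enn2real (\<integral>\<^sup>+x. \<integral>\<^sup>+y. ennreal (f x y) \<partial>q \<partial>p)"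
    using assms(2) by (subst integral_eq_nn_integral) (auto simp: nn_integral_pair_pmf' case_prod_beta)
  also have "\<dots> = enn2real (\<integral>\<^sup>+x. ennreal (measure_pmf.expectation q (f x)) \<partial>p)"
    using assms by (subst nn_integral_eq_integral) (auto intro: integrable_measure_pmf_finite)
  also have "\<dots> = measure_pmf.expectation p (\<lambda>x. measure_pmf.expectation q (f x))"
    using assms(2) by (subst integral_eq_nn_integral) (auto intro: integral_nonneg_AE)
  finally show ?thesis .
qed

context valid_policy_system
begin

text \<open>Domination holds in law, not path by path: different servers offer independent services,
  so the real queue may be the shorter one. The induction therefore runs over all monotone g.
  Peeling off the last slot replaces g by its image under the genie operator, which is monotone
  again, and passing to the actual service rate only increases the value.\<close>

lemma queue_dominates_genie:
  fixes g :: "nat \<Rightarrow> real"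
  assumes u: "u < U" "0 \<le> lam u" "lam u \<le> 1"
    and mu: "\<And>k. k < K \<Longrightarrow> 0 \<le> mu u k \<and> mu u k \<le> 1"
    and opt: "opt_server K mu u < K" "\<And>k. k < K \<Longrightarrow> mu u k \<le> mu u (opt_server K mu u)"
    and g: "mono g"
  shows "measure_pmf.expectation (traj U K lam mu pol t) (\<lambda>h. g (genie_len K mu u q0 h))
    \<le> measure_pmf.expectation (traj U K lam mu pol t) (\<lambda>h. g (queue_len u q0 h))"
  using g
proof (induction t arbitrary: g)
  case 0
  show ?case by (rule expectation_mono_pmf) (simp_all add: queue_len_def genie_len_def)
next
  case (Suc t)
  let ?s = "mu u (opt_server K mu u)"
  have mono: "mono (queue_op (lam u) ?s g)"
    using u mu opt Suc.prems by (intro queue_op_mono) auto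
  have "measure_pmf.expectation (traj U K lam mu pol (Suc t)) (\<lambda>h. g (genie_len K mu u q0 h))
    = measure_pmf.expectation (traj U K lam mu pol t) (\<lambda>h. queue_op (lam u) ?s g (genie_len K mu u q0 h))"
    using u mu opt by (simp add: expectation_traj_Suc expectation_qstep_server del: traj.simps)
  also have "\<dots> \<le> measure_pmf.expectation (traj U K lam mu pol t) (\<lambda>h. queue_op (lam u) ?s g (queue_len u q0 h))"
    by (rule Suc.IH[OF mono])
  also have "\<dots> = measure_pmf.expectation (traj U K lam mu pol t) (\<lambda>h.
      measure_pmf.expectation (pol (map observe h)) (\<lambda>m. queue_op (lam u) ?s g (queue_len u q0 h)))"
    by simp
  also have "\<dots> \<le> measure_pmf.expectation (traj U K lam mu pol t) (\<lambda>h.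
      measure_pmf.expectation (pol (map observe h)) (\<lambda>m.
       measure_pmf.expectation (arrivals_pmf U lam) (\<lambda>a.
      measure_pmf.expectation (services_pmf U K mu) (\<lambda>r. g (qstep (queue_len u q0 h) (a u) (served m r u))))))"
  proof (intro expectation_mono_pmf finite_set_policy finite_set_traj)
    fix h m assume "m \<in> set_pmf (pol (map observe h))"
    then have m: "valid_matching U K m" by (rule valid_matching_policy)
    have "service_rate mu m u \<le> ?s"
      using m mu[OF opt(1)] opt(2) by (auto simp: service_rate_def valid_matching_def split: option.splits)
    then show "queue_op (lam u) ?s g (queue_len u q0 h) \<le>
      measure_pmf.expectation (arrivals_pmf U lam) (\<lambda>a.
      measure_pmf.expectation (services_pmf U K mu) (\<lambda>r. g (qstep (queue_len u q0 h) (a u) (served m r u))))"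
      using u mu m Suc.prems by (subst expectation_qstep_served) (auto intro: queue_op_antimono_rate)
  qed
  also have "\<dots> = measure_pmf.expectation (traj U K lam mu pol (Suc t)) (\<lambda>h. g (queue_len u q0 h))"
    by (simp add: expectation_traj_Suc del: traj.simps)
  finally show ?case .
qed

text \<open>Only the last slot is exploited: up to then the queue dominates the genie queue, and if an
  arrival occurs in that slot, a rate deficit of d costs d in expectation.\<close>
lemma queue_minus_genie_ge:
  assumes u: "u < U" "0 \<le> lam u" "lam u \<le> 1"
    and mu: "\<And>k. k < K \<Longrightarrow> 0 \<le> mu u k \<and> mu u k \<le> 1"
    and opt: "opt_server K mu u < K"
    and d: "0 \<le> d" "d \<le> mu u (opt_server K mu u)"
      "\<And>k. k < K \<Longrightarrow> k \<noteq> opt_server K mu u \<Longrightarrow> mu u k + d \<le> mu u (opt_server K mu u)"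
  defines "miss \<equiv> exp_count U K lam mu pol (\<lambda>m. m u \<noteq> Some (opt_server K mu u))"
  shows "measure_pmf.expectation (traj U K lam mu pol (Suc t)) (\<lambda>h. real (genie_len K mu u q0 h))
      + lam u * d * (miss (Suc t) - miss t)
    \<le> measure_pmf.expectation (traj U K lam mu pol (Suc t)) (\<lambda>h. real (queue_len u q0 h))"
proof -
  let ?k = "opt_server K mu u"
  let ?s = "mu u ?k"
  have le: "mu u k \<le> ?s" if "k < K" for k
    using d(1) d(3)[OF that] by (cases "k = ?k") auto
  have mono: "mono (queue_op (lam u) ?s real)"
    using u mu opt by (intro queue_op_mono) (auto simp: mono_def)
  have "measure_pmf.expectation (traj U K lam mu pol (Suc t)) (\<lambda>h. real (genie_len K mu u q0 h))
    = measure_pmf.expectation (traj U K lam mu pol t) (\<lambda>h. queue_op (lam u) ?s real (genie_len K mu u q0 h))"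
    using u mu opt by (simp add: expectation_traj_Suc expectation_qstep_server del: traj.simps)
  also have "\<dots> \<le> measure_pmf.expectation (traj U K lam mu pol t) (\<lambda>h. queue_op (lam u) ?s real (queue_len u q0 h))"
    by (rule queue_dominates_genie[where lam = lam and mu = mu and u = u, OF u mu opt le mono])
  finally have "measure_pmf.expectation (traj U K lam mu pol (Suc t)) (\<lambda>h. real (genie_len K mu u q0 h))
      + lam u * d * (miss (Suc t) - miss t)
    \<le> measure_pmf.expectation (traj U K lam mu pol t) (\<lambda>h. queue_op (lam u) ?s real (queue_len u q0 h))
      + lam u * d * (miss (Suc t) - miss t)" by simp
  also have "\<dots> = measure_pmf.expectation (traj U K lam mu pol t) (\<lambda>h.
      measure_pmf.expectation (pol (map observe h)) (\<lambda>m.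
        queue_op (lam u) ?s real (queue_len u q0 h) + lam u * d * of_bool (m u \<noteq> Some ?k)))"
    unfolding miss_def exp_count_Suc by (simp add: integrable_measure_pmf_finite)
  also have "\<dots> \<le> measure_pmf.expectation (traj U K lam mu pol t) (\<lambda>h.
      measure_pmf.expectation (pol (map observe h)) (\<lambda>m.
      measure_pmf.expectation (arrivals_pmf U lam) (\<lambda>a.
      measure_pmf.expectation (services_pmf U K mu) (\<lambda>r. real (qstep (queue_len u q0 h) (a u) (served m r u))))))"
  proof (intro expectation_mono_pmf finite_set_policy finite_set_traj)
    fix h m assume "m \<in> set_pmf (pol (map observe h))"
    then have m: "valid_matching U K m" by (rule valid_matching_policy)
    let ?q = "queue_len u q0 h"
    \<comment> \<open>An idle queue has service rate 0, and this case is covered by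
      \<open>d \<le> ?s\<close>.\<close>
    have rate: "service_rate mu m u + d * of_bool (m u \<noteq> Some ?k) \<le> ?s"
      using m d by (auto simp: service_rate_def valid_matching_def split: option.splits)
    have "service_rate mu m u \<le> ?s" using rate d(1) by (smt (verit) mult_nonneg_nonneg of_bool_def)
    then have "queue_op (lam u) ?s real ?q + (?s - service_rate mu m u) * lam u
        \<le> queue_op (lam u) (service_rate mu m u) real ?q"
      using u by (intro queue_op_real_rate) auto
    moreover have "lam u * d * of_bool (m u \<noteq> Some ?k) \<le> (?s - service_rate mu m u) * lam u"
      using mult_left_mono[OF rate u(2)] by (simp add: algebra_simps)
    ultimately show "queue_op (lam u) ?s real ?q + lam u * d * of_bool (m u \<noteq> Some ?k) \<le>
      measure_pmf.expectation (arrivals_pmf U lam) (\<lambda>a.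
      measure_pmf.expectation (services_pmf U K mu) (\<lambda>r. real (qstep ?q (a u) (served m r u))))"
      using u mu m by (subst expectation_qstep_served[where g=real]) auto
  qed
  also have "\<dots> = measure_pmf.expectation (traj U K lam mu pol (Suc t)) (\<lambda>h. real (queue_len u q0 h))"
    by (simp add: expectation_traj_Suc del: traj.simps)
  finally show ?thesis .
qed

lemma regret_geI:
  assumes int: "integrable (init_dist K lam mu u) real"
    and le: "\<And>q0. measure_pmf.expectation (traj U K lam mu pol t) (\<lambda>h. real (genie_len K mu u q0 h)) + c
    \<le> measure_pmf.expectation (traj U K lam mu pol t) (\<lambda>h. real (queue_len u q0 h))"
  shows "c \<le> regret U K lam mu pol u t"
proof -
  let ?I = "init_dist K lam mu u" and ?T = "traj U K lam mu pol t"
  \<comment> \<open>Within t slots a queue grows by at most t, so its mean is dominated by q0 + t,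
    which is integrable under the initial law.\<close>
  have dom: "integrable ?I (\<lambda>q0. measure_pmf.expectation ?T (\<lambda>h. real (f q0 h)))"
    if f: "\<And>q0 h. f q0 h \<le> q0 + length h" for f
  proof (rule Bochner_Integration.integrable_bound)
    show "integrable ?I (\<lambda>q0. real q0 + real t)" using int by simp
    show "AE q0 in ?I. norm (measure_pmf.expectation ?T (\<lambda>h. real (f q0 h))) \<le> norm (real q0 + real t)"
    proof (rule AE_I2)
      fix q0
      have "measure_pmf.expectation ?T (\<lambda>h. real (f q0 h)) \<le> measure_pmf.expectation ?T (\<lambda>h. real q0 + real t)"
      proof (rule expectation_mono_pmf[OF finite_set_traj])
        fix h assume "h \<in> set_pmf ?T"
        then show "real (f q0 h) \<le> real q0 + real t"
          using f[of q0 h] length_traj by fastforce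
      qed
      moreover have "0 \<le> measure_pmf.expectation ?T (\<lambda>h. real (f q0 h))" by simp
      ultimately show "norm (measure_pmf.expectation ?T (\<lambda>h. real (f q0 h))) \<le> norm (real q0 + real t)"
        by simp
    qed
  qed simp
  note dq = dom[OF queue_len_le] and dg = dom[OF genie_len_le]
  have "measure_pmf.expectation ?I (\<lambda>q0. measure_pmf.expectation ?T (\<lambda>h. real (genie_len K mu u q0 h))) + c
     = measure_pmf.expectation ?I (\<lambda>q0. measure_pmf.expectation ?T (\<lambda>h. real (genie_len K mu u q0 h)) + c)"
    using dg by simp
  also have "\<dots> \<le> measure_pmf.expectation ?I (\<lambda>q0. measure_pmf.expectation ?T (\<lambda>h. real (queue_len u q0 h)))"
    by (intro integral_mono dq le) (simp add: dg)
  finally show ?thesis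
    unfolding regret_def by (simp add: expectation_pair_pmf_nonneg)
qed

end

section \<open>Problem instances\<close>

lemma opt_server_eqI:
  assumes "k < K" "\<And>k'. k' < K \<Longrightarrow> k' \<noteq> k \<Longrightarrow> mu u k' < mu u k"
  shows "opt_server K mu u = k"
  unfolding opt_server_def
proof (rule the_equality)
  fix j assume j: "j < K \<and> (\<forall>k'<K. k' \<noteq> j \<longrightarrow> mu u k' < mu u j)"
  show "j = k"
  proof (rule ccontr)
    assume "j \<noteq> k"
    then have "mu u j < mu u k" "mu u k < mu u j" using assms j by auto
    then show False by simp
  qed
qed (use assms in auto)

lemma mu_star_eqI:
  assumes "k < K" "\<And>k'. k' < K \<Longrightarrow> k' \<noteq> k \<Longrightarrow> mu u k' < mu u k"
  shows "mu_star K mu u = mu u k"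
  unfolding mu_star_def
proof (rule Max_eqI)
  fix y assume "y \<in> {mu u k |k. k < K}"
  then obtain j where "y = mu u j" "j < K" by auto
  then show "y \<le> mu u k" using assms(2)[of j] by (cases "j = k") auto
qed (use assms in auto)

lemma finite_pair_image: "finite {f u k | u k. u < (U::nat) \<and> k < (K::nat) \<and> P u k}"
proof (rule finite_subset)
  show "{f u k | u k. u < U \<and> k < K \<and> P u k} \<subseteq> (\<lambda>(u, k). f u k) ` ({..<U} \<times> {..<K})" by auto
qed simp

text \<open>The chord of the concave ln between \<delta> and 1. It makes the bound on ln of a usage
  fraction x linear in x, so that taking expectations yields an expected count.\<close>

lemma ln_interpolation:
  fixes x \<delta> :: real
  assumes "0 \<le> x" "x \<le> 1" "0 < \<delta>"
  shows "(1 - x) * ln \<delta> \<le> ln (x + \<delta>)"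
proof -
  have "x * ln 1 + (1 - x) * ln \<delta> \<le> ln (x * 1 + (1 - x) * \<delta>)"
    using ln_concave assms unfolding concave_on_iff
    by (elim conjE ballE[of _ _ 1] ballE[of _ _ \<delta>] allE[of _ x] allE[of _ "1 - x"]) auto
  also have "\<dots> \<le> ln (x + \<delta>)"
  proof (subst ln_le_cancel_iff)
    show "0 < x * 1 + (1 - x) * \<delta>" using assms by (cases "x = 0") (auto intro: add_pos_nonneg)
  qed (use assms in \<open>auto simp: algebra_simps\<close>)
  finally show ?thesis by simp
qed

locale problem_instance = valid_policy_system +
  fixes lam :: "nat \<Rightarrow> real" and mu :: "nat \<Rightarrow> nat \<Rightarrow> real"
  assumes inst: "valid_instance U K lam mu"
begin

abbreviation "opt \<equiv> opt_server K mu"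

abbreviation "miss u \<equiv> exp_count U K lam mu pol (\<lambda>m. m u \<noteq> Some (opt u))"

lemma sizes: "1 \<le> U" "U \<le> K"
  using inst by (auto simp: valid_instance_def)

lemma lam_bounds: "u < U \<Longrightarrow> 0 \<le> lam u \<and> lam u \<le> 1"
  using inst by (auto simp: valid_instance_def)

lemma mu_bounds: "u < U \<Longrightarrow> k < K \<Longrightarrow> 0 \<le> mu u k \<and> mu u k \<le> 1"
  using inst by (auto simp: valid_instance_def)

lemma
  assumes "u < U"
  shows opt_less: "opt u < K"
    and mu_less_opt: "\<And>k. k < K \<Longrightarrow> k \<noteq> opt u \<Longrightarrow> mu u k < mu u (opt u)"
    and mu_star_opt: "mu_star K mu u = mu u (opt u)"
proof -
  obtain k where k: "k < K" "\<And>k'. k' < K \<Longrightarrow> k' \<noteq> k \<Longrightarrow> mu u k' < mu u k"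
    using inst assms by (auto simp: valid_instance_def)
  have "opt u = k" using k by (rule opt_server_eqI)
  with k mu_star_eqI[of k K mu u, OF k]
  show "opt u < K" "\<And>k. k < K \<Longrightarrow> k \<noteq> opt u \<Longrightarrow> mu u k < mu u (opt u)" "mu_star K mu u = mu u (opt u)"
    by auto
qed

lemma lam_less_opt: "u < U \<Longrightarrow> lam u < mu u (opt u)"
  using inst mu_star_opt by (auto simp: valid_instance_def)

lemma inj_opt: "inj_on opt {..<U}"
  using inst by (auto simp: valid_instance_def inj_on_def)

lemma mu_le_opt: "u < U \<Longrightarrow> k < K \<Longrightarrow> mu u k \<le> mu u (opt u)"
  using mu_less_opt[of u k] by (cases "k = opt u") auto

lemma integrable_init: "u < U \<Longrightarrow> integrable (init_dist K lam mu u) real"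
  unfolding init_dist_def
  using lam_bounds mu_bounds opt_less mu_star_opt lam_less_opt by (intro integrable_stat_dist) auto

lemma regret_nonneg:
  assumes "u < U"
  shows "0 \<le> regret U K lam mu pol u t"
proof (rule regret_geI[OF integrable_init[OF assms]])
  fix q0
  have "mono real" by (simp add: mono_def)
  then show "measure_pmf.expectation (traj U K lam mu pol t) (\<lambda>h. real (genie_len K mu u q0 h)) + 0
    \<le> measure_pmf.expectation (traj U K lam mu pol t) (\<lambda>h. real (queue_len u q0 h))"
    using queue_dominates_genie[of u lam mu real t q0] assms lam_bounds mu_bounds opt_less mu_le_opt by simp
qed

lemma mu_min_le: "u < U \<Longrightarrow> k < K \<Longrightarrow> mu_min U K mu \<le> mu u k"
  unfolding mu_min_def using finite_pair_image[of mu U K "\<lambda>_ _. True"] by (intro Min_le) auto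

lemma mu_max_ge: "u < U \<Longrightarrow> k < K \<Longrightarrow> mu u k \<le> mu_max U K mu"
  unfolding mu_max_def using finite_pair_image[of mu U K "\<lambda>_ _. True"] by (intro Max_ge) auto

lemma mu_min_nonneg: "0 \<le> mu_min U K mu"
proof -
  have "mu_min U K mu \<in> {mu u k |u k. u < U \<and> k < K}"
    unfolding mu_min_def using finite_pair_image[of mu U K "\<lambda>_ _. True"] sizes
    by (intro Min_in) (auto intro!: exI[of _ "0::nat"])
  then show ?thesis using mu_bounds by auto
qed

lemma mu_max_le_1: "mu_max U K mu \<le> 1"
proof -
  have "mu_max U K mu \<in> {mu u k |u k. u < U \<and> k < K}"
    unfolding mu_max_def using finite_pair_image[of mu U K "\<lambda>_ _. True"] sizes
    by (intro Max_in) (auto intro!: exI[of _ "0::nat"])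
  then show ?thesis using mu_bounds by auto
qed

lemma lam_min_le: "u < U \<Longrightarrow> lam_min U lam \<le> lam u"
  unfolding lam_min_def by (intro Min_le) auto

lemma lam_min_nonneg: "0 \<le> lam_min U lam"
proof -
  have "lam_min U lam \<in> {lam u |u. u < U}"
    unfolding lam_min_def using sizes by (intro Min_in) (auto intro!: exI[of _ 0])
  then show ?thesis using lam_bounds by auto
qed

lemma gap_le:
  assumes "u < U" "k < K" "k \<noteq> opt u"
  shows "mu u k + gap U K mu \<le> mu u (opt u)"
proof -
  have "gap U K mu \<le> mu_star K mu u - mu u k"
    unfolding gap_def using finite_pair_image[of "\<lambda>u k. mu_star K mu u - mu u k" U K "\<lambda>u k. k \<noteq> opt u"] assms
    by (intro Min_le) auto
  then show ?thesis using mu_star_opt assms by simp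
qed

lemma ex_suboptimal:
  assumes "2 \<le> K"
  obtains k where "k < K" "k \<noteq> opt u"
proof (cases "opt u = 0")
  case True
  then show ?thesis using that[of 1] assms by simp
next
  case False
  then show ?thesis using that[of 0] assms by simp
qed

lemma gap_pos:
  assumes "2 \<le> K"
  shows "0 < gap U K mu"
proof -
  let ?S = "{mu_star K mu u - mu u k | u k. u < U \<and> k < K \<and> k \<noteq> opt u}"
  have "?S \<noteq> {}" using ex_suboptimal[OF assms, of 0] sizes by fastforce
  then have "gap U K mu \<in> ?S"
    unfolding gap_def
    using finite_pair_image[of "\<lambda>u k. mu_star K mu u - mu u k" U K "\<lambda>u k. k \<noteq> opt u"]
    by (intro Min_in) auto
  then show ?thesis using mu_less_opt mu_star_opt by auto
qed

lemma regret_Suc_ge: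
  assumes "2 \<le> K" "u < U"
  shows "lam u * gap U K mu * (miss u (Suc t) - miss u t) \<le> regret U K lam mu pol u (Suc t)"
proof (rule regret_geI[OF integrable_init[OF assms(2)]])
  fix q0
  obtain k where k: "k < K" "k \<noteq> opt u" using ex_suboptimal[OF assms(1)] by blast
  \<comment> \<open>Needed for idle slots: a suboptimal server has a nonnegative rate, so being
    served at rate 0 also costs at least the gap.\<close>
  have "gap U K mu \<le> mu u (opt u)"
    using gap_le[OF assms(2) k] mu_bounds[OF assms(2) k(1)] by simp
  then show "measure_pmf.expectation (traj U K lam mu pol (Suc t)) (\<lambda>h. real (genie_len K mu u q0 h))
      + lam u * gap U K mu * (miss u (Suc t) - miss u t)
    \<le> measure_pmf.expectation (traj U K lam mu pol (Suc t)) (\<lambda>h. real (queue_len u q0 h))"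
    using lam_bounds mu_bounds opt_less gap_le gap_pos assms
    by (intro queue_minus_genie_ge) (auto simp: less_imp_le)
qed

text \<open>Here \<sigma> is the assignment that is to become optimal. Queues with
  \<open>\<sigma> v = opt v\<close> keep all their rates, so one construction covers both moving a
  single queue and exchanging two.\<close>

definition alter :: "(nat \<Rightarrow> nat) \<Rightarrow> real \<Rightarrow> nat \<Rightarrow> nat \<Rightarrow> real" where
  "alter \<sigma> q v j = (if \<sigma> v \<noteq> opt v \<and> j = \<sigma> v then q else mu v j)"

text \<open>As q exceeds every old rate, the raised server is the unique best one; injectivity of
  \<sigma> keeps the optimal servers distinct. Arrivals are unchanged and no optimal rate drops, so
  stability persists.\<close>

lemma
  assumes \<sigma>: "inj_on \<sigma> {..<U}" "\<And>v. v < U \<Longrightarrow> \<sigma> v < K"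
    and q: "\<And>v j. v < U \<Longrightarrow> j < K \<Longrightarrow> mu v j < q" "q \<le> 1"
  shows opt_alter: "v < U \<Longrightarrow> opt_server K (alter \<sigma> q) v = \<sigma> v"
    and valid_alter: "valid_instance U K lam (alter \<sigma> q)"
proof -
  have best: "alter \<sigma> q v j < alter \<sigma> q v (\<sigma> v)" if "v < U" "j < K" "j \<noteq> \<sigma> v" for v j
    using that q mu_less_opt[of v j] by (auto simp: alter_def)
  have opt': "opt_server K (alter \<sigma> q) v = \<sigma> v" if "v < U" for v
    using that best \<sigma> by (intro opt_server_eqI) auto
  have star: "mu_star K (alter \<sigma> q) v = alter \<sigma> q v (\<sigma> v)" if "v < U" for v
    using that best \<sigma> by (intro mu_star_eqI) auto
  show "v < U \<Longrightarrow> opt_server K (alter \<sigma> q) v = \<sigma> v" by (rule opt')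
  have bounds: "0 \<le> alter \<sigma> q v j \<and> alter \<sigma> q v j \<le> 1" if "v < U" "j < K" for v j
    using mu_bounds[OF that] q(1)[OF that] q(2) by (auto simp: alter_def)
  have stable: "0 < mu_star K (alter \<sigma> q) v - lam v" if "v < U" for v
    using lam_less_opt[OF that] q(1)[OF that opt_less[OF that]] star[OF that] by (auto simp: alter_def)
  have "\<exists>k<K. \<forall>k'<K. k' \<noteq> k \<longrightarrow> alter \<sigma> q v k' < alter \<sigma> q v k" if "v < U" for v
    using that best \<sigma>(2) by blast
  moreover have "opt_server K (alter \<sigma> q) v \<noteq> opt_server K (alter \<sigma> q) v'" if "v < U" "v' < U" "v \<noteq> v'" for v v'
    using that opt' \<sigma>(1) by (auto simp: inj_on_def)
  ultimately show "valid_instance U K lam (alter \<sigma> q)"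
    unfolding valid_instance_def using sizes lam_bounds bounds stable by blast
qed

text \<open>A uniform price per altered slot: by \<open>KL_antimono\<close> the smallest rate is the
  dearest one to raise to the midpoint.\<close>

definition divergence :: real where
  "divergence = KL (mu_min U K mu) ((mu_max U K mu + 1) / 2)"

lemma divergence_nonneg:
  assumes "mu_max U K mu < 1"
  shows "0 \<le> divergence"
proof -
  have "0 < U" "0 < K" using sizes by auto
  then have "mu_min U K mu \<le> mu 0 0" "mu 0 0 \<le> mu_max U K mu" "0 \<le> mu 0 0"
    using mu_min_le mu_max_ge mu_bounds by auto
  then show ?thesis
    unfolding divergence_def using mu_min_nonneg assms by (intro KL_nonneg) auto
qed

text \<open>Under the altered rates the policy must abandon the server that is optimal for u, so its
  fraction of slots F has small mean there; if it is close to 1 under the true rates, the altered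
  pairs must have been sampled often.  The offset t powr (\<alpha> - 1) keeps ln F finite.\<close>
lemma altered_pulls_ge:
  assumes cons: "consistent U K \<alpha> pol" and mx: "mu_max U K mu < 1"
    and \<sigma>: "inj_on \<sigma> {..<U}" "\<And>v. v < U \<Longrightarrow> \<sigma> v < K"
    and u: "u < U" "\<sigma> u \<noteq> opt u"
  shows "\<exists>c. \<forall>\<^sub>F t in sequentially. (1 - \<alpha>) * ln (real t) * (1 - miss u t / real t) - c
    \<le> divergence * (\<Sum>v | v < U \<and> \<sigma> v \<noteq> opt v. exp_pulls U K lam mu pol v (\<sigma> v) t)"
proof -
  \<comment> \<open>The midpoint lies above every rate, which makes the altered server best, and
    below 1, which keeps the divergence finite.\<close>
  define q where "q = (mu_max U K mu + 1) / 2"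
  define B where "B = (\<lambda>v. (v, \<sigma> v)) ` {v. v < U \<and> \<sigma> v \<noteq> opt v}"
  have mq: "mu v j < q" if "v < U" "j < K" for v j
    using mu_max_ge[OF that] mx by (simp add: q_def)
  have q: "0 < q" "q < 1"
    using mq[of 0 0] mu_bounds[of 0 0] sizes mx by (auto simp: q_def)
  note valid = valid_alter[OF \<sigma> mq less_imp_le[OF q(2)]]
  have "opt_server K (alter \<sigma> q) u = \<sigma> u"
    using opt_alter[OF \<sigma> mq less_imp_le[OF q(2)]] u by blast
  then have "exp_pulls U K lam (alter \<sigma> q) pol u (opt u) \<in> O(\<lambda>t. real t powr \<alpha>)"
    using cons valid u opt_less unfolding consistent_def by metis
  then obtain C where C: "C > 0"
    "\<forall>\<^sub>F t in sequentially. norm (exp_pulls U K lam (alter \<sigma> q) pol u (opt u) t) \<le> C * norm (real t powr \<alpha>)"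
    by (elim landau_o.bigE)
  show ?thesis
  proof (rule exI[of _ "ln (C + 1)"], rule eventually_mono[OF eventually_conj[OF C(2) eventually_gt_at_top[of 0]]])
    fix t assume "norm (exp_pulls U K lam (alter \<sigma> q) pol u (opt u) t) \<le> C * norm (real t powr \<alpha>) \<and> 0 < t"
    then have pulls: "exp_pulls U K lam (alter \<sigma> q) pol u (opt u) t \<le> C * real t powr \<alpha>" and t: "0 < t"
      by auto
    \<comment> \<open>By consistency the altered mean of the usage fraction is at most C \<delta>.
      An offset of the same order therefore costs only the additive constant ln (C + 1).\<close>
    define \<delta> where "\<delta> = real t powr (\<alpha> - 1)"
    have \<delta>: "\<delta> > 0" "ln \<delta> = (\<alpha> - 1) * ln (real t)" "real t powr \<alpha> / real t = \<delta>"
      using t by (simp_all add: \<delta>_def ln_powr, simp add: powr_diff)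
    define F where "F x = real (length (filter (\<lambda>(m, a, s). m u = Some (opt u)) x)) / real t + \<delta>" for x :: "obs list"
    have Fpos: "F x > 0" for x using \<delta>(1) t by (auto simp: F_def intro: add_nonneg_pos)
    have Fobs: "F (map observe h) = real (length (filter (\<lambda>(m, a, r). m u = Some (opt u)) h)) / real t + \<delta>" for h
    proof -
      have "(\<lambda>(m, a, s). m u = Some (opt u)) \<circ> observe = (\<lambda>(m, a, r). m u = Some (opt u))"
        by (auto simp: observe_def)
      then show ?thesis by (simp add: F_def filter_map)
    qed
    have "measure_pmf.expectation (traj U K lam (alter \<sigma> q) pol t) (\<lambda>h. F (map observe h))
        = exp_pulls U K lam (alter \<sigma> q) pol u (opt u) t / real t + \<delta>"
      unfolding Fobs exp_pulls_def by (simp add: integrable_measure_pmf_finite)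
    also have "\<dots> \<le> C * real t powr \<alpha> / real t + \<delta>"
      using pulls t by (intro add_mono divide_right_mono) auto
    also have "\<dots> = (C + 1) * \<delta>" by (simp add: distrib_right add_divide_distrib flip: \<delta>(3))
    finally have "ln (measure_pmf.expectation (traj U K lam (alter \<sigma> q) pol t) (\<lambda>h. F (map observe h)))
        \<le> ln ((C + 1) * \<delta>)"
      by (intro ln_mono expectation_pos_pmf finite_set_traj Fpos)
    also have "\<dots> = ln (C + 1) + (\<alpha> - 1) * ln (real t)"
      using C(1) \<delta> by (simp add: ln_mult)
    finally have Q: "ln (measure_pmf.expectation (traj U K lam (alter \<sigma> q) pol t) (\<lambda>h. F (map observe h)))
        \<le> ln (C + 1) + (\<alpha> - 1) * ln (real t)" .
    \<comment> \<open>If x is the fraction of slots in which u has its optimal server, the missed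
      fraction is 1 - x, and \<open>ln_interpolation\<close> bounds ln F below by (1 - x) ln
      \<delta>.\<close>
    have "miss u t / real t * ln \<delta> = measure_pmf.expectation (traj U K lam mu pol t)
        (\<lambda>h. real (length (filter (\<lambda>(m, a, r). m u \<noteq> Some (opt u)) h)) / real t * ln \<delta>)"
      unfolding exp_count_def by simp
    also have "\<dots> \<le> measure_pmf.expectation (traj U K lam mu pol t) (\<lambda>h. ln (F (map observe h)))"
    proof (rule expectation_mono_pmf[OF finite_set_traj])
      fix h assume "h \<in> set_pmf (traj U K lam mu pol t)"
      then have h: "length h = t" by (rule length_traj)
      let ?x = "real (length (filter (\<lambda>(m, a, r). m u = Some (opt u)) h)) / real t"
      have "length (filter (\<lambda>(m, a, r). m u = Some (opt u)) h)
          + length (filter (\<lambda>(m, a, r). m u \<noteq> Some (opt u)) h) = length h"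
        by (induction h) auto
      then have "real (length (filter (\<lambda>(m, a, r). m u \<noteq> Some (opt u)) h)) / real t = 1 - ?x"
        using h t by (simp add: field_simps flip: of_nat_add)
      moreover have "?x \<le> 1"
        using t length_filter_le[of "\<lambda>(m, a, r). m u = Some (opt u)" h] unfolding h by simp
      ultimately show "real (length (filter (\<lambda>(m, a, r). m u \<noteq> Some (opt u)) h)) / real t * ln \<delta>
          \<le> ln (F (map observe h))"
        using ln_interpolation[of ?x \<delta>] \<delta>(1) by (simp add: Fobs)
    qed
    finally have P: "miss u t / real t * ln \<delta>
        \<le> measure_pmf.expectation (traj U K lam mu pol t) (\<lambda>h. ln (F (map observe h)))" .
    have "measure_pmf.expectation (traj U K lam mu pol t) (\<lambda>h. ln (F (map observe h)))
      - divergence * (\<Sum>(v, j)\<in>B. exp_pulls U K lam mu pol v j t)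
      \<le> ln (measure_pmf.expectation (traj U K lam (alter \<sigma> q) pol t) (\<lambda>h. F (map observe h)))"
    proof (rule traj_Donsker_Varadhan)
      show "B \<subseteq> {..<U} \<times> {..<K}" using \<sigma>(2) by (auto simp: B_def)
      show "0 \<le> divergence" using mx by (rule divergence_nonneg)
      show "alter \<sigma> q v j = mu v j" if "v < U" "(v, j) \<notin> B" for v j
        using that by (auto simp: alter_def B_def)
      show "0 < alter \<sigma> q v j \<and> alter \<sigma> q v j < 1 \<and> KL (mu v j) (alter \<sigma> q v j) \<le> divergence"
        if "(v, j) \<in> B" for v j
      proof -
        have vj: "v < U" "j < K" "alter \<sigma> q v j = q"
          using that \<sigma>(2) by (auto simp: alter_def B_def)
        show ?thesis
          unfolding vj divergence_def using q KL_antimono[OF mu_min_nonneg mu_min_le[OF vj(1,2)] mq[OF vj(1,2)]]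
          by (simp add: q_def)
      qed
      show "0 \<le> mu v j \<and> mu v j \<le> 1 \<and> 0 \<le> alter \<sigma> q v j \<and> alter \<sigma> q v j \<le> 1" if "v < U" "j < K" for v j
        using mu_bounds[OF that] q by (auto simp: alter_def)
    qed (rule Fpos)
    also have "(\<Sum>(v, j)\<in>B. exp_pulls U K lam mu pol v j t) =
        (\<Sum>v | v < U \<and> \<sigma> v \<noteq> opt v. exp_pulls U K lam mu pol v (\<sigma> v) t)"
      unfolding B_def by (subst sum.reindex) (auto simp: inj_on_def)
    finally have DV: "measure_pmf.expectation (traj U K lam mu pol t) (\<lambda>h. ln (F (map observe h)))
      - divergence * (\<Sum>v | v < U \<and> \<sigma> v \<noteq> opt v. exp_pulls U K lam mu pol v (\<sigma> v) t)
      \<le> ln (measure_pmf.expectation (traj U K lam (alter \<sigma> q) pol t) (\<lambda>h. F (map observe h)))" .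
    have "(1 - \<alpha>) * ln (real t) * (1 - x) = x * ((\<alpha> - 1) * ln (real t)) - (\<alpha> - 1) * ln (real t)" for x
      by (simp add: algebra_simps)
    then show "(1 - \<alpha>) * ln (real t) * (1 - miss u t / real t) - ln (C + 1)
      \<le> divergence * (\<Sum>v | v < U \<and> \<sigma> v \<noteq> opt v. exp_pulls U K lam mu pol v (\<sigma> v) t)"
      using P[unfolded \<delta>(2)] Q DV by simp
  qed
qed

end

section \<open>Logarithmic lower bound\<close>

text \<open>Telescoping against 1 / (t + 1) \<le> ln (t + 1) - ln t. It turns a regret bound per
  slot into a bound on the expected number of missed slots.\<close>

lemma log_growth_of_harmonic_increments:
  fixes w :: "nat \<Rightarrow> real"
  assumes inc: "\<forall>\<^sub>F t in sequentially. w (Suc t) - w t \<le> C / real (Suc t)" and C: "0 \<le> C"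
  shows "\<exists>b. \<forall>\<^sub>F t in sequentially. w t \<le> C * ln (real t) + b"
proof -
  obtain N where N: "\<And>t. t \<ge> N \<Longrightarrow> w (Suc t) - w t \<le> C / real (Suc t)"
    using inc by (auto simp: eventually_sequentially)
  \<comment> \<open>The shift by one keeps t positive, so that ln t is meaningful.\<close>
  define M where "M = Suc N"
  have "w t \<le> C * ln (real t) + (w M - C * ln (real M))" if "t \<ge> M" for t
    using that
  proof (induction t rule: dec_induct)
    case (step t)
    then have t: "t \<ge> N" "t > 0" by (auto simp: M_def)
    have "ln (real t / real (Suc t)) \<le> real t / real (Suc t) - 1"
      using t by (intro ln_le_minus_one) auto
    then have "1 / real (Suc t) \<le> ln (real (Suc t)) - ln (real t)"
      using t by (simp add: ln_div field_simps)
    then have "C * (1 / real (Suc t)) \<le> C * (ln (real (Suc t)) - ln (real t))"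
      using C by (rule mult_left_mono)
    then show ?case using step.IH N[OF t(1)] by (simp add: right_diff_distrib)
  qed simp
  then show ?thesis unfolding eventually_sequentially by blast
qed

lemma log_bounds_contradiction:
  fixes w :: "nat \<Rightarrow> real"
  assumes "\<forall>\<^sub>F t in sequentially. w t \<le> C * ln (real t) + b"
    and "\<forall>\<^sub>F t in sequentially. C' * ln (real t) - b' \<le> w t" and "C < C'"
  shows False
proof -
  have "filterlim (\<lambda>t. ln (real t)) at_top sequentially"
    by (rule filterlim_compose[OF ln_at_top filterlim_real_sequentially])
  then have "\<forall>\<^sub>F t in sequentially. ln (real t) > (b + b') / (C' - C)"
    by (simp add: filterlim_at_top_dense)
  then have "\<forall>\<^sub>F t in sequentially. False"
    using assms(1,2)
  proof eventually_elim
    case (elim t)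
    then have "b + b' < (C' - C) * ln (real t)" using \<open>C < C'\<close> by (simp add: field_simps)
    then show False using elim by (simp add: algebra_simps)
  qed
  then show False by simp
qed

lemma sum_log_lower_bound:
  fixes f :: "'i \<Rightarrow> nat \<Rightarrow> real"
  assumes "finite I" "\<And>i. i \<in> I \<Longrightarrow> \<exists>c. \<forall>\<^sub>F t in sequentially. A * ln (real t) - c \<le> f i t"
  shows "\<exists>c. \<forall>\<^sub>F t in sequentially. real (card I) * A * ln (real t) - c \<le> (\<Sum>i\<in>I. f i t)"
proof -
  obtain c where c: "\<And>i. i \<in> I \<Longrightarrow> \<forall>\<^sub>F t in sequentially. A * ln (real t) - c i \<le> f i t"
    using assms(2) by metis
  then have "\<forall>\<^sub>F t in sequentially. \<forall>i\<in>I. A * ln (real t) - c i \<le> f i t"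
    using assms(1) by (intro eventually_ball_finite) auto
  then have "\<forall>\<^sub>F t in sequentially. real (card I) * A * ln (real t) - sum c I \<le> (\<Sum>i\<in>I. f i t)"
  proof eventually_elim
    case (elim t)
    then have "(\<Sum>i\<in>I. A * ln (real t) - c i) \<le> (\<Sum>i\<in>I. f i t)" by (intro sum_mono) auto
    then show ?case by (simp add: sum_subtractf)
  qed
  then show ?thesis by blast
qed

lemma sum_of_bool_le:
  assumes "finite I" "\<And>i j. i \<in> I \<Longrightarrow> j \<in> I \<Longrightarrow> P i \<Longrightarrow> P j \<Longrightarrow> i = j" "\<And>i. i \<in> I \<Longrightarrow> P i \<Longrightarrow> R"
  shows "(\<Sum>i\<in>I. of_bool (P i)) \<le> (of_bool R :: real)"
proof (cases "\<exists>i\<in>I. P i")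
  case True
  then obtain i where i: "i \<in> I" "P i" by blast
  have "(\<Sum>i\<in>I. of_bool (P i)) = (\<Sum>j\<in>I. if j = i then 1 else 0 :: real)"
    using assms(2) i by (intro sum.cong) auto
  then show ?thesis using assms(1,3) i by simp
qed simp

section \<open>Missed slots forced by consistency\<close>

context problem_instance
begin

text \<open>The assumed logarithmic bound makes the missed fraction tend to 0, so 1 minus it
  eventually exceeds 1/2. The values of a and b do not enter the conclusion.\<close>

lemma altered_pulls_ge_log:
  assumes "consistent U K \<alpha> pol" "\<alpha> < 1" "mu_max U K mu < 1"
    and "inj_on \<sigma> {..<U}" "\<And>v. v < U \<Longrightarrow> \<sigma> v < K" "u < U" "\<sigma> u \<noteq> opt u"
    and miss: "\<forall>\<^sub>F t in sequentially. miss u t \<le> a * ln (real t) + b"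
  shows "\<exists>c. \<forall>\<^sub>F t in sequentially. (1 - \<alpha>) / 2 * ln (real t) - c
    \<le> divergence * (\<Sum>v | v < U \<and> \<sigma> v \<noteq> opt v. exp_pulls U K lam mu pol v (\<sigma> v) t)"
proof -
  obtain c where c: "\<forall>\<^sub>F t in sequentially. (1 - \<alpha>) * ln (real t) * (1 - miss u t / real t) - c
    \<le> divergence * (\<Sum>v | v < U \<and> \<sigma> v \<noteq> opt v. exp_pulls U K lam mu pol v (\<sigma> v) t)"
    using altered_pulls_ge[OF assms(1,3-7)] by blast
  have "(\<lambda>t. a * (ln (real t) / real t) + b * (1 / real t)) \<longlonglongrightarrow> a * 0 + b * 0"
    by (intro tendsto_intros lim_ln_over_n lim_1_over_n)
  then have "\<forall>\<^sub>F t in sequentially. a * (ln (real t) / real t) + b * (1 / real t) < 1 / 2"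
    by (rule order_tendstoD) simp
  then have "\<forall>\<^sub>F t in sequentially. (1 - \<alpha>) / 2 * ln (real t) - c
    \<le> divergence * (\<Sum>v | v < U \<and> \<sigma> v \<noteq> opt v. exp_pulls U K lam mu pol v (\<sigma> v) t)"
    using c miss eventually_gt_at_top[of 0]
  proof eventually_elim
    case (elim t)
    have "miss u t / real t \<le> (a * ln (real t) + b) / real t"
      using elim by (intro divide_right_mono) auto
    also have "\<dots> < 1 / 2" using elim by (simp add: add_divide_distrib)
    finally have "1 / 2 \<le> 1 - miss u t / real t" by simp
    then have "(1 - \<alpha>) * ln (real t) * (1 / 2) \<le> (1 - \<alpha>) * ln (real t) * (1 - miss u t / real t)"
      using elim \<open>\<alpha> < 1\<close> by (intro mult_left_mono) auto
    moreover have "(1 - \<alpha>) / 2 * ln (real t) = (1 - \<alpha>) * ln (real t) * (1 / 2)" by simp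
    ultimately show ?case using elim(2) by linarith
  qed
  then show ?thesis by blast
qed

text \<open>A server that is optimal for no queue can be given to u without displacing another
  queue, so a single altered pair bears the whole bound.\<close>

lemma pulls_unused_server_ge:
  assumes "consistent U K \<alpha> pol" "\<alpha> < 1" "mu_max U K mu < 1" "u < U"
    and miss: "\<forall>\<^sub>F t in sequentially. miss u t \<le> a * ln (real t) + b"
    and k: "k < K" "k \<notin> opt ` {..<U}"
  shows "\<exists>c. \<forall>\<^sub>F t in sequentially. (1 - \<alpha>) / 2 * ln (real t) - c
    \<le> divergence * exp_pulls U K lam mu pol u k t"
proof -
  let ?\<sigma> = "opt(u := k)"
  have "inj_on ?\<sigma> {..<U}"
    using inj_opt k by (auto simp: inj_on_def)
  moreover have "?\<sigma> v < K" if "v < U" for v using that k opt_less by auto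
  moreover have "?\<sigma> u \<noteq> opt u" using k \<open>u < U\<close> by auto
  moreover have "{v. v < U \<and> ?\<sigma> v \<noteq> opt v} = {u}" using k \<open>u < U\<close> by auto
  ultimately show ?thesis
    using altered_pulls_ge_log[OF assms(1-3) _ _ assms(4) _ miss, of ?\<sigma>] by simp
qed

text \<open>The servers of u and u' have to be exchanged, as a server that is optimal for another queue
  cannot be made optimal for u alone.\<close>
lemma pulls_exchanged_servers_ge:
  assumes "consistent U K \<alpha> pol" "\<alpha> < 1" "mu_max U K mu < 1" "u < U"
    and miss: "\<forall>\<^sub>F t in sequentially. miss u t \<le> a * ln (real t) + b"
    and u': "u' < U" "u' \<noteq> u"
  shows "\<exists>c. \<forall>\<^sub>F t in sequentially. (1 - \<alpha>) / 2 * ln (real t) - c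
    \<le> divergence * (exp_pulls U K lam mu pol u (opt u') t + exp_pulls U K lam mu pol u' (opt u) t)"
proof -
  let ?\<sigma> = "opt(u := opt u', u' := opt u)"
  have ne: "opt u \<noteq> opt u'" using inj_opt u' \<open>u < U\<close> by (auto simp: inj_on_def)
  have "inj_on ?\<sigma> {..<U}"
    using inj_opt u' \<open>u < U\<close> by (auto simp: inj_on_def)
  moreover have "?\<sigma> v < K" if "v < U" for v using that u' \<open>u < U\<close> opt_less by auto
  moreover have "?\<sigma> u \<noteq> opt u" using ne u' by auto
  moreover have "{v. v < U \<and> ?\<sigma> v \<noteq> opt v} = {u, u'}" using ne u' \<open>u < U\<close> by auto
  ultimately show ?thesis
    using altered_pulls_ge_log[OF assms(1-3) _ _ assms(4) _ miss, of ?\<sigma>] u' by simp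
qed

lemma sum_pulls_le_miss:
  assumes "finite S" "opt u \<notin> S"
  shows "(\<Sum>k\<in>S. exp_pulls U K lam mu pol u k t) \<le> miss u t"
  unfolding exp_pulls_eq_exp_count
  using assms by (intro sum_exp_count_le sum_of_bool_le) auto

text \<open>A server serves at most one queue per slot: at most one v holds \<open>opt u\<close>,
  and u then cannot.\<close>

lemma sum_stolen_le_miss:
  assumes "u < U"
  shows "(\<Sum>v\<in>{..<U} - {u}. exp_pulls U K lam mu pol v (opt u) t) \<le> miss u t"
  unfolding exp_pulls_eq_exp_count
  using assms by (intro sum_exp_count_le sum_of_bool_le) (auto simp: valid_matching_def)

lemma miss_ge_log:
  assumes cons: "consistent U K \<alpha> pol" "\<alpha> < 1" and mx: "mu_max U K mu < 1" and u: "u < U"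
    and div: "0 < divergence"
    and miss: "\<forall>\<^sub>F t in sequentially. miss u t \<le> a * ln (real t) + b"
  shows "\<exists>c. \<forall>\<^sub>F t in sequentially.
    (1 - \<alpha>) / divergence * max (real U - 1) (2 * (real K - real U)) / 4 * ln (real t) - c \<le> miss u t"
proof -
  define S where "S = {..<K} - opt ` {..<U}"
  have cardS: "real (card S) = real K - real U"
  proof -
    have "opt ` {..<U} \<subseteq> {..<K}" using opt_less by auto
    then show ?thesis
      using sizes card_image[OF inj_opt] by (simp add: S_def card_Diff_subset of_nat_diff)
  qed
  obtain c1 where c1: "\<forall>\<^sub>F t in sequentially. real (card S) * ((1 - \<alpha>) / 2) * ln (real t) - c1
      \<le> (\<Sum>k\<in>S. divergence * exp_pulls U K lam mu pol u k t)"
    using sum_log_lower_bound[of S "(1 - \<alpha>) / 2" "\<lambda>k t. divergence * exp_pulls U K lam mu pol u k t"]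
      pulls_unused_server_ge[OF cons mx u miss] by (auto simp: S_def)
  have b1: "\<forall>\<^sub>F t in sequentially.
    (1 - \<alpha>) / divergence * (2 * (real K - real U)) / 4 * ln (real t) - c1 / divergence \<le> miss u t"
    using c1
  proof eventually_elim
    case (elim t)
    have "(\<Sum>k\<in>S. exp_pulls U K lam mu pol u k t) \<le> miss u t"
      using u by (intro sum_pulls_le_miss) (auto simp: S_def)
    then have "(\<Sum>k\<in>S. divergence * exp_pulls U K lam mu pol u k t) \<le> divergence * miss u t"
      using div by (simp flip: sum_distrib_left)
    with elim have "(real K - real U) * ((1 - \<alpha>) / 2) * ln (real t) - c1 \<le> divergence * miss u t"
      by (simp add: cardS)
    then have "((real K - real U) * ((1 - \<alpha>) / 2) * ln (real t) - c1) / divergence \<le> miss u t"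
      using div by (simp add: pos_divide_le_eq mult.commute)
    moreover have "((real K - real U) * ((1 - \<alpha>) / 2) * ln (real t) - c1) / divergence =
        (1 - \<alpha>) / divergence * (2 * (real K - real U)) / 4 * ln (real t) - c1 / divergence"
      using div by (simp add: field_simps)
    ultimately show ?case by simp
  qed
  define I where "I = {..<U} - {u}"
  have cardI: "real (card I) = real U - 1"
    using u sizes by (simp add: I_def of_nat_diff)
  obtain c2 where c2: "\<forall>\<^sub>F t in sequentially. real (card I) * ((1 - \<alpha>) / 2) * ln (real t) - c2
      \<le> (\<Sum>v\<in>I. divergence * (exp_pulls U K lam mu pol u (opt v) t + exp_pulls U K lam mu pol v (opt u) t))"
    using sum_log_lower_bound[of I "(1 - \<alpha>) / 2" "\<lambda>v t. divergence *
        (exp_pulls U K lam mu pol u (opt v) t + exp_pulls U K lam mu pol v (opt u) t)"]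
      pulls_exchanged_servers_ge[OF cons mx u miss] by (auto simp: I_def)
  have b2: "\<forall>\<^sub>F t in sequentially.
    (1 - \<alpha>) / divergence * (real U - 1) / 4 * ln (real t) - c2 / (2 * divergence) \<le> miss u t"
    using c2
  proof eventually_elim
    case (elim t)
    have inj: "inj_on opt I" using inj_opt by (rule inj_on_subset) (auto simp: I_def)
    have "(\<Sum>v\<in>I. exp_pulls U K lam mu pol u (opt v) t) = (\<Sum>k\<in>opt ` I. exp_pulls U K lam mu pol u k t)"
      by (simp add: sum.reindex[OF inj])
    also have "\<dots> \<le> miss u t"
      using u inj_opt by (intro sum_pulls_le_miss) (auto simp: I_def inj_on_def)
    \<comment> \<open>The factor 2 is the double charge: in one slot u may hold the optimal server
      of another queue while some queue holds that of u.\<close>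
    finally have "(\<Sum>v\<in>I. exp_pulls U K lam mu pol u (opt v) t + exp_pulls U K lam mu pol v (opt u) t) \<le> 2 * miss u t"
      using sum_stolen_le_miss[OF u, of t] by (simp add: sum.distrib I_def)
    then have "(\<Sum>v\<in>I. divergence * (exp_pulls U K lam mu pol u (opt v) t + exp_pulls U K lam mu pol v (opt u) t))
        \<le> divergence * (2 * miss u t)"
      using div by (simp flip: sum_distrib_left)
    with elim have "(real U - 1) * ((1 - \<alpha>) / 2) * ln (real t) - c2 \<le> divergence * (2 * miss u t)"
      by (simp add: cardI)
    then have "((real U - 1) * ((1 - \<alpha>) / 2) * ln (real t) - c2) / (2 * divergence) \<le> miss u t"
      using div by (simp add: pos_divide_le_eq mult_ac)
    moreover have "((real U - 1) * ((1 - \<alpha>) / 2) * ln (real t) - c2) / (2 * divergence) =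
        (1 - \<alpha>) / divergence * (real U - 1) / 4 * ln (real t) - c2 / (2 * divergence)"
      using div by (simp add: field_simps)
    ultimately show ?case by simp
  qed
  show ?thesis using b1 b2 by (auto simp: max_def)
qed

end

theorem theorem5:
  fixes U K :: nat and lam :: "nat \<Rightarrow> real" and mu :: "nat \<Rightarrow> nat \<Rightarrow> real"
    and pol :: policy and \<alpha> :: real
  assumes inst: "valid_instance U K lam mu"
    and alpha: "0 < \<alpha>" "\<alpha> < 1"
    and pol: "valid_policy U K pol"
    and cons: "consistent U K \<alpha> pol"
  shows "(\<exists>\<^sub>F t in sequentially.
            (1 / real U) * (\<Sum>u<U. regret U K lam mu pol u t)
              \<ge> (lam_min U lam / 8 * D_const U K mu * (1 - \<alpha>) * (real K - 1)) / real t)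
       \<and> (\<forall>u<U. \<exists>\<^sub>F t in sequentially.
            regret U K lam mu pol u t
              \<ge> (lam_min U lam / 8 * D_const U K mu * (1 - \<alpha>)
                   * max (real U - 1) (2 * (real K - real U))) / real t)"
proof -
  interpret problem_instance U K pol lam mu
    using inst pol by unfold_locales
  define M where "M = max (real U - 1) (2 * (real K - real U))"
  have freqI: "\<exists>\<^sub>F t in sequentially. P t" if "\<And>t. P t" for P :: "nat \<Rightarrow> bool"
    using that by (simp add: frequently_def)
  show ?thesis
    unfolding M_def[symmetric]
  proof (cases "K < 2 \<or> mu_max U K mu = 1 \<or> divergence = 0 \<or> lam_min U lam = 0")
    case True
    \<comment> \<open>Each degenerate case makes the constants 0: directly through
      \<open>lam_min\<close> or \<open>D_const\<close>, by division by a zero divergence, or because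
      K = 1 forces U = 1. Nonnegativity of the regret then suffices.\<close>
    have zero: "lam_min U lam / 8 * D_const U K mu * (1 - \<alpha>) * (real K - 1) = 0"
      "lam_min U lam / 8 * D_const U K mu * (1 - \<alpha>) * M = 0"
      using True sizes by (auto simp: D_const_def divergence_def M_def)
    show "(\<exists>\<^sub>F t in sequentially.
            (1 / real U) * (\<Sum>u<U. regret U K lam mu pol u t)
              \<ge> (lam_min U lam / 8 * D_const U K mu * (1 - \<alpha>) * (real K - 1)) / real t)
       \<and> (\<forall>u<U. \<exists>\<^sub>F t in sequentially.
            regret U K lam mu pol u t \<ge> (lam_min U lam / 8 * D_const U K mu * (1 - \<alpha>) * M) / real t)"
      unfolding zero by (intro conjI allI impI freqI) (auto intro!: divide_nonneg_nonneg sum_nonneg regret_nonneg)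
  next
    case False
    then have K: "2 \<le> K" and mx: "mu_max U K mu < 1" and div: "0 < divergence" and lam: "0 < lam_min U lam"
      using mu_max_le_1 divergence_nonneg lam_min_nonneg by (auto simp: less_le)
    define A where "A = (1 - \<alpha>) / divergence"
    define s where "s = lam_min U lam * gap U K mu"
    have A: "0 < A" using div alpha by (simp add: A_def)
    have s: "0 < s" using lam gap_pos[OF K] by (simp add: s_def)
    \<comment> \<open>The maximum is at least the average of U - 1 and 2 (K - U) with weights 2/3
      and 1/3, which is 2 (K - 1) / 3.\<close>
    have M: "0 < M" "2 * (real K - 1) / 3 \<le> M" using K sizes by (auto simp: M_def max_def)
    have const: "lam_min U lam / 8 * D_const U K mu * (1 - \<alpha>) * x = s * (A * x / 8)" for x
      using mx by (simp add: D_const_def divergence_def A_def s_def)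
    have inc: "s * (miss u (Suc t) - miss u t) \<le> regret U K lam mu pol u (Suc t)" if "u < U" for u t
    proof -
      have "s * (miss u (Suc t) - miss u t) \<le> lam u * gap U K mu * (miss u (Suc t) - miss u t)"
        using lam_min_le[OF that] gap_pos[OF K] exp_count_le_Suc unfolding s_def
        by (intro mult_right_mono) auto
      then show ?thesis using regret_Suc_ge[OF K that, of t] by linarith
    qed
    note lower = miss_ge_log[OF cons alpha(2) mx _ div, folded M_def A_def]
    show "(\<exists>\<^sub>F t in sequentially.
            (1 / real U) * (\<Sum>u<U. regret U K lam mu pol u t)
              \<ge> (lam_min U lam / 8 * D_const U K mu * (1 - \<alpha>) * (real K - 1)) / real t)
       \<and> (\<forall>u<U. \<exists>\<^sub>F t in sequentially.
            regret U K lam mu pol u t \<ge> (lam_min U lam / 8 * D_const U K mu * (1 - \<alpha>) * M) / real t)"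
      unfolding const
    proof (intro conjI allI impI)
      show "\<exists>\<^sub>F t in sequentially. s * (A * (real K - 1) / 8) / real t
          \<le> (1 / real U) * (\<Sum>u<U. regret U K lam mu pol u t)"
      proof (rule ccontr)
        define w where "w t = (\<Sum>u<U. miss u t)" for t
        assume "\<not> ?thesis"
        then have ev: "\<forall>\<^sub>F t in sequentially. (1 / real U) * (\<Sum>u<U. regret U K lam mu pol u t)
            < s * (A * (real K - 1) / 8) / real t"
          by (simp add: not_frequently not_le)
        have "\<forall>\<^sub>F t in sequentially. w (Suc t) - w t \<le> real U * (A * (real K - 1) / 8) / real (Suc t)"
          using ev[THEN eventually_sequentially_Suc[THEN iffD2]]
        proof eventually_elim
          case (elim t)
          have "s * (w (Suc t) - w t) = (\<Sum>u<U. s * (miss u (Suc t) - miss u t))"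
            by (simp add: w_def sum_subtractf sum_distrib_left right_diff_distrib)
          also have "\<dots> \<le> (\<Sum>u<U. regret U K lam mu pol u (Suc t))"
            by (intro sum_mono inc) auto
          also have "\<dots> \<le> real U * (s * (A * (real K - 1) / 8) / real (Suc t))"
            using elim sizes by (simp add: field_simps)
          also have "\<dots> = s * (real U * (A * (real K - 1) / 8) / real (Suc t))" by simp
          finally show ?case using s by (simp only: mult_le_cancel_left_pos)
        qed
        then obtain b where b: "\<forall>\<^sub>F t in sequentially. w t \<le> real U * (A * (real K - 1) / 8) * ln (real t) + b"
          using log_growth_of_harmonic_increments[of w] A K by fastforce
        \<comment> \<open>Bounding one queue by the whole sum loses a factor U, harmlessly:
          \<open>miss_ge_log\<close> needs some logarithmic bound, with any constant.\<close>
        have miss: "\<forall>\<^sub>F t in sequentially. miss u t \<le> real U * (A * (real K - 1) / 8) * ln (real t) + b"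
          if "u < U" for u
          using b
        proof eventually_elim
          case (elim t)
          have "miss u t \<le> w t"
            unfolding w_def using that by (intro member_le_sum) (auto simp: exp_count_nonneg)
          then show ?case using elim by simp
        qed
        obtain c where c: "\<forall>\<^sub>F t in sequentially. real (card {..<U}) * (A * M / 4) * ln (real t) - c \<le> w t"
          unfolding w_def using sum_log_lower_bound[of "{..<U}" "A * M / 4" miss] lower[OF _ miss] by auto
        \<comment> \<open>This is 1/8 < 1/6, the slack left in (a).\<close>
        have "A * (real K - 1) / 8 < A * (2 * (real K - 1) / 3) / 4" using A K by simp
        also have "\<dots> \<le> A * M / 4" using A M(2) by (intro divide_right_mono mult_left_mono) auto
        finally have "real U * (A * (real K - 1) / 8) < real (card {..<U}) * (A * M / 4)"
          using sizes unfolding card_lessThan by (intro mult_strict_left_mono) auto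
        then show False using log_bounds_contradiction[OF b c] by simp
      qed
    next
      fix u assume u: "u < U"
      show "\<exists>\<^sub>F t in sequentially. s * (A * M / 8) / real t \<le> regret U K lam mu pol u t"
      proof (rule ccontr)
        assume "\<not> ?thesis"
        then have ev: "\<forall>\<^sub>F t in sequentially. regret U K lam mu pol u t < s * (A * M / 8) / real t"
          by (simp add: not_frequently not_le)
        have "\<forall>\<^sub>F t in sequentially. miss u (Suc t) - miss u t \<le> A * M / 8 / real (Suc t)"
          using ev[THEN eventually_sequentially_Suc[THEN iffD2]]
        proof eventually_elim
          case (elim t)
          have "s * (miss u (Suc t) - miss u t) \<le> s * (A * M / 8 / real (Suc t))"
            using inc[OF u, of t] elim by simp
          then show ?case using s by (simp only: mult_le_cancel_left_pos)
        qed
        then obtain b where b: "\<forall>\<^sub>F t in sequentially. miss u t \<le> A * M / 8 * ln (real t) + b"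
          using log_growth_of_harmonic_increments[of "miss u"] A M by fastforce
        obtain c where "\<forall>\<^sub>F t in sequentially. A * M / 4 * ln (real t) - c \<le> miss u t"
          using lower[OF u b] by blast
        moreover have "A * M / 8 < A * M / 4" using A M by simp
        ultimately show False using log_bounds_contradiction[OF b] by blast
      qed
    qed
  qed
qed

end
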